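(* Let $H,G$ be bounded prelinear Hilbert algebras. Let $i_H:H^*\to H^*\coprod_{\mathsf{PHey}}G^*$ and $i_G:G^*\to H^*\coprod_{\mathsf{PHey}}G^*$ be the canonical morphisms of the coproduct of $H^*$ and $G^*$ in the category $\mathsf{PHey}$ of prelinear Heyting algebras, and put $$\eta_{GH}=i_H(\varphi_H(H))\cup i_G(\varphi_G(G)).$$ Let $\langle\eta_{GH}\rangle_{\mathsf{PHil_0}}$ be the Hilbert subalgebra of $H^*\coprod_{\mathsf{PHey}}G^*$ generated by $\eta_{GH}$. Then the coproduct of $H$ and $G$ in the category $\mathsf{PHil_0}$ of bounded prelinear Hilbert algebras satisfies $$H\coprod_{\mathsf{PHil_0}}G\cong\langle\eta_{GH}\rangle_{\mathsf{PHil_0}}.$$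
   Context: A Hilbert algebra is an algebra $(H,\to,1)$ of type $(2,0)$ such that for all $a,b,c\in H$: $a\to(b\to a)=1$; $(a\to(b\to c))\to((a\to b)\to(a\to c))=1$; and $a\to b=b\to a=1$ implies $a=b$. Its natural order is $a\le b$ iff $a\to b=1$. A Hilbert chain is a Hilbert algebra whose natural order is total; a prelinear Hilbert algebra is a member of the variety generated by the Hilbert chains. A bounded prelinear Hilbert algebra is $(H,\to,1,0)$ with $(H,\to,1)$ a prelinear Hilbert algebra and $0\le a$ for all $a$; $\mathsf{PHil_0}$ is the category of these with homomorphisms preserving $\to,1,0$. $\mathsf{PHey}$ is the category of Heyting algebras satisfying $(x\to y)\vee(y\to x)=1$ and Heyting homomorphisms. An implicative filter of $H$ is a subset $F$ with $1\in F$ such that $a,a\to b\in F$ imply $b\in F$; it is irreducible if $F\ne H$ and $F=F_1\cap F_2$ with $F_i$ implicative filters implies $F=F_1$ or $F=F_2$. $X(H)$ is the set of irreducible implicative filters, ordered by inclusion. $X(H)^+$ is the Heyting algebra of upsets of $(X(H),\subseteq)$ with $\cap,\cup,\emptyset,X(H)$ and $U\Rightarrow V=(U\cap V^c]^c$, where $(Y]$ denotes generated downset and $^c$ complement. $\varphi_H(a)=\{P\in X(H):a\in P\}$, and $H^*$ is the Heyting subalgebra of $X(H)^+$ generated by $\varphi_H(H)$; it is a prelinear Heyting algebra, and $\varphi_H$ is regarded as a map $H\to H^*$. *)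

theory Defs
  imports "HOL-Algebra.Congruence" "HOL-Library.Countable"
begin

section \<open>Signatures\<close>

record 'a hilbert = "'a partial_object" +
  imp :: "'a \<Rightarrow> 'a \<Rightarrow> 'a" (infixr "\<Rrightarrow>\<index>" 60)
  one :: 'a ("\<one>\<index>")

record 'a hilbert0 = "'a hilbert" +
  zero :: 'a ("\<zero>\<index>")

record 'a heyting = "'a hilbert0" +
  meet :: "'a \<Rightarrow> 'a \<Rightarrow> 'a" (infixl "\<sqinter>\<index>" 70)
  join :: "'a \<Rightarrow> 'a \<Rightarrow> 'a" (infixl "\<squnion>\<index>" 65)


section \<open>Hilbert algebras\<close>

locale hilbert_algebra =
  fixes H :: "('a, 'm) hilbert_scheme" (structure)
  assumes one_closed: "\<one> \<in> carrier H"
    and imp_closed: "\<lbrakk>a \<in> carrier H; b \<in> carrier H\<rbrakk> \<Longrightarrow> a \<Rrightarrow> b \<in> carrier H"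
    and imp_K: "\<lbrakk>a \<in> carrier H; b \<in> carrier H\<rbrakk> \<Longrightarrow> a \<Rrightarrow> (b \<Rrightarrow> a) = \<one>"
    and imp_S: "\<lbrakk>a \<in> carrier H; b \<in> carrier H; c \<in> carrier H\<rbrakk> \<Longrightarrow>
      (a \<Rrightarrow> (b \<Rrightarrow> c)) \<Rrightarrow> ((a \<Rrightarrow> b) \<Rrightarrow> (a \<Rrightarrow> c)) = \<one>"
    and imp_antisym: "\<lbrakk>a \<in> carrier H; b \<in> carrier H; a \<Rrightarrow> b = \<one>; b \<Rrightarrow> a = \<one>\<rbrakk> \<Longrightarrow> a = b"

definition nat_le :: "('a, 'm) hilbert_scheme \<Rightarrow> 'a \<Rightarrow> 'a \<Rightarrow> bool" where
  "nat_le H a b \<longleftrightarrow> imp H a b = one H"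

locale hilbert_chain = hilbert_algebra +
  assumes total: "\<lbrakk>a \<in> carrier H; b \<in> carrier H\<rbrakk> \<Longrightarrow> nat_le H a b \<or> nat_le H b a"

datatype 'v hilbert_term = HVar 'v | HOne | HImp "'v hilbert_term" "'v hilbert_term"

instance hilbert_term :: (countable) countable
  by countable_datatype

primrec hilbert_eval :: "('a, 'm) hilbert_scheme \<Rightarrow> ('v \<Rightarrow> 'a) \<Rightarrow> 'v hilbert_term \<Rightarrow> 'a" where
  "hilbert_eval H v (HVar x) = v x"
| "hilbert_eval H v HOne = one H"
| "hilbert_eval H v (HImp s t) = imp H (hilbert_eval H v s) (hilbert_eval H v t)"

definition hilbert_identity ::
  "('a, 'm) hilbert_scheme \<Rightarrow> nat hilbert_term \<Rightarrow> nat hilbert_term \<Rightarrow> bool" where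
  "hilbert_identity H s t \<longleftrightarrow>
    (\<forall>v. range v \<subseteq> carrier H \<longrightarrow> hilbert_eval H v s = hilbert_eval H v t)"

text \<open>
  The variety generated by the Hilbert chains is the class of all algebras that satisfy every
  identity valid in all Hilbert chains. It is enough to test an identity on the chains whose
  carrier is a set of natural numbers: see \<open>hilbert_identity_all_chains\<close> below, which
  passes to chains of arbitrary type.
\<close>

definition chain_identity :: "nat hilbert_term \<Rightarrow> nat hilbert_term \<Rightarrow> bool" where
  "chain_identity s t \<longleftrightarrow> (\<forall>K :: nat hilbert. hilbert_chain K \<longrightarrow> hilbert_identity K s t)"

definition prelinear_hilbert :: "('a, 'm) hilbert_scheme \<Rightarrow> bool" where
  "prelinear_hilbert H \<longleftrightarrow>
    hilbert_algebra H \<and> (\<forall>s t. chain_identity s t \<longrightarrow> hilbert_identity H s t)"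

definition PHil0 :: "('a, 'm) hilbert0_scheme \<Rightarrow> bool" where
  "PHil0 H \<longleftrightarrow> prelinear_hilbert H \<and> zero H \<in> carrier H \<and> (\<forall>a \<in> carrier H. nat_le H (zero H) a)"

definition PHil0_hom ::
  "('a, 'm) hilbert0_scheme \<Rightarrow> ('b, 'n) hilbert0_scheme \<Rightarrow> ('a \<Rightarrow> 'b) set" where
  "PHil0_hom H K = {f. f ` carrier H \<subseteq> carrier K \<and> f (one H) = one K \<and> f (zero H) = zero K \<and>
    (\<forall>a \<in> carrier H. \<forall>b \<in> carrier H. f (imp H a b) = imp K (f a) (f b))}"

definition PHil0_isomorphic ::
  "('a, 'm) hilbert0_scheme \<Rightarrow> ('b, 'n) hilbert0_scheme \<Rightarrow> bool" where
  "PHil0_isomorphic H K \<longleftrightarrow> (\<exists>f \<in> PHil0_hom H K. bij_betw f (carrier H) (carrier K))"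

inductive_set hilbert_span :: "('a, 'm) hilbert_scheme \<Rightarrow> 'a set \<Rightarrow> 'a set"
  for H :: "('a, 'm) hilbert_scheme" and S :: "'a set" where
  base: "x \<in> S \<Longrightarrow> x \<in> hilbert_span H S"
| one: "one H \<in> hilbert_span H S"
| imp: "\<lbrakk>x \<in> hilbert_span H S; y \<in> hilbert_span H S\<rbrakk> \<Longrightarrow> imp H x y \<in> hilbert_span H S"

text \<open>
  The ambient \<open>zero\<close> is kept as the designated constant; it is an element of the
  generated subalgebra only if it happens to lie in the span.
\<close>

definition hilbert_generated :: "('a, 'm) hilbert0_scheme \<Rightarrow> 'a set \<Rightarrow> 'a hilbert0" where
  "hilbert_generated H S =
    \<lparr>carrier = hilbert_span H S, imp = imp H, one = one H, zero = zero H\<rparr>"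


section \<open>Prelinear Heyting algebras\<close>

locale heyting_algebra =
  fixes A :: "('a, 'm) heyting_scheme" (structure)
  assumes one_closed: "\<one> \<in> carrier A"
    and zero_closed: "\<zero> \<in> carrier A"
    and imp_closed: "\<lbrakk>a \<in> carrier A; b \<in> carrier A\<rbrakk> \<Longrightarrow> a \<Rrightarrow> b \<in> carrier A"
    and meet_closed: "\<lbrakk>a \<in> carrier A; b \<in> carrier A\<rbrakk> \<Longrightarrow> a \<sqinter> b \<in> carrier A"
    and join_closed: "\<lbrakk>a \<in> carrier A; b \<in> carrier A\<rbrakk> \<Longrightarrow> a \<squnion> b \<in> carrier A"
    and meet_comm: "\<lbrakk>a \<in> carrier A; b \<in> carrier A\<rbrakk> \<Longrightarrow> a \<sqinter> b = b \<sqinter> a"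
    and join_comm: "\<lbrakk>a \<in> carrier A; b \<in> carrier A\<rbrakk> \<Longrightarrow> a \<squnion> b = b \<squnion> a"
    and meet_assoc: "\<lbrakk>a \<in> carrier A; b \<in> carrier A; c \<in> carrier A\<rbrakk> \<Longrightarrow>
      (a \<sqinter> b) \<sqinter> c = a \<sqinter> (b \<sqinter> c)"
    and join_assoc: "\<lbrakk>a \<in> carrier A; b \<in> carrier A; c \<in> carrier A\<rbrakk> \<Longrightarrow>
      (a \<squnion> b) \<squnion> c = a \<squnion> (b \<squnion> c)"
    and meet_absorb: "\<lbrakk>a \<in> carrier A; b \<in> carrier A\<rbrakk> \<Longrightarrow> a \<sqinter> (a \<squnion> b) = a"
    and join_absorb: "\<lbrakk>a \<in> carrier A; b \<in> carrier A\<rbrakk> \<Longrightarrow> a \<squnion> (a \<sqinter> b) = a"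
    and meet_one: "a \<in> carrier A \<Longrightarrow> a \<sqinter> \<one> = a"
    and join_zero: "a \<in> carrier A \<Longrightarrow> a \<squnion> \<zero> = a"
    \<comment> \<open>with \<open>x \<le> y\<close> written as \<open>x \<sqinter> y = x\<close>:
       \<open>a \<sqinter> b \<le> c\<close> iff \<open>a \<le> b \<Rrightarrow> c\<close>\<close>
    and residuation: "\<lbrakk>a \<in> carrier A; b \<in> carrier A; c \<in> carrier A\<rbrakk> \<Longrightarrow>
      (a \<sqinter> b) \<sqinter> c = a \<sqinter> b \<longleftrightarrow> a \<sqinter> (b \<Rrightarrow> c) = a"

locale PHey = heyting_algebra +
  assumes prelinear: "\<lbrakk>a \<in> carrier A; b \<in> carrier A\<rbrakk> \<Longrightarrow> (a \<Rrightarrow> b) \<squnion> (b \<Rrightarrow> a) = \<one>"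

definition PHey_hom ::
  "('a, 'm) heyting_scheme \<Rightarrow> ('b, 'n) heyting_scheme \<Rightarrow> ('a \<Rightarrow> 'b) set" where
  "PHey_hom A B = {f. f ` carrier A \<subseteq> carrier B \<and> f (one A) = one B \<and> f (zero A) = zero B \<and>
    (\<forall>a \<in> carrier A. \<forall>b \<in> carrier A. f (imp A a b) = imp B (f a) (f b) \<and>
      f (meet A a b) = meet B (f a) (f b) \<and> f (join A a b) = join B (f a) (f b))}"

inductive_set heyting_span :: "('a, 'm) heyting_scheme \<Rightarrow> 'a set \<Rightarrow> 'a set"
  for A :: "('a, 'm) heyting_scheme" and S :: "'a set" where
  base: "x \<in> S \<Longrightarrow> x \<in> heyting_span A S"
| one: "one A \<in> heyting_span A S"
| zero: "zero A \<in> heyting_span A S"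
| imp: "\<lbrakk>x \<in> heyting_span A S; y \<in> heyting_span A S\<rbrakk> \<Longrightarrow> imp A x y \<in> heyting_span A S"
| meet: "\<lbrakk>x \<in> heyting_span A S; y \<in> heyting_span A S\<rbrakk> \<Longrightarrow> meet A x y \<in> heyting_span A S"
| join: "\<lbrakk>x \<in> heyting_span A S; y \<in> heyting_span A S\<rbrakk> \<Longrightarrow> join A x y \<in> heyting_span A S"

definition heyting_generated :: "'a heyting \<Rightarrow> 'a set \<Rightarrow> 'a heyting" where
  "heyting_generated A S = A\<lparr>carrier := heyting_span A S\<rparr>"

datatype 'v heyting_term = Var 'v | One | Zero
  | Imp "'v heyting_term" "'v heyting_term"
  | Meet "'v heyting_term" "'v heyting_term"
  | Join "'v heyting_term" "'v heyting_term"


section \<open>The prelinear Heyting algebra of a bounded prelinear Hilbert algebra\<close>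

definition implicative_filter :: "('a, 'm) hilbert_scheme \<Rightarrow> 'a set \<Rightarrow> bool" where
  "implicative_filter H F \<longleftrightarrow> F \<subseteq> carrier H \<and> one H \<in> F \<and>
    (\<forall>a \<in> carrier H. \<forall>b \<in> carrier H. a \<in> F \<and> imp H a b \<in> F \<longrightarrow> b \<in> F)"

definition irreducible_filter :: "('a, 'm) hilbert_scheme \<Rightarrow> 'a set \<Rightarrow> bool" where
  "irreducible_filter H F \<longleftrightarrow> implicative_filter H F \<and> F \<noteq> carrier H \<and>
    (\<forall>F1 F2. implicative_filter H F1 \<and> implicative_filter H F2 \<and> F = F1 \<inter> F2 \<longrightarrow> F = F1 \<or> F = F2)"

definition irr_filters :: "('a, 'm) hilbert_scheme \<Rightarrow> 'a set set" where
  "irr_filters H = {P. irreducible_filter H P}"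

definition upsets :: "'p set set \<Rightarrow> 'p set set set" where
  "upsets X = {U. U \<subseteq> X \<and> (\<forall>P \<in> U. \<forall>Q \<in> X. P \<subseteq> Q \<longrightarrow> Q \<in> U)}"

definition downset_of :: "'p set set \<Rightarrow> 'p set set \<Rightarrow> 'p set set" where
  "downset_of X Y = {P \<in> X. \<exists>Q \<in> Y. P \<subseteq> Q}"

definition upset_algebra :: "'p set set \<Rightarrow> 'p set set heyting" where
  "upset_algebra X =
    \<lparr>carrier = upsets X,
     imp = (\<lambda>U V. X - downset_of X (U \<inter> (X - V))),
     one = X, zero = {}, meet = (\<inter>), join = (\<union>)\<rparr>"

definition phi :: "('a, 'm) hilbert_scheme \<Rightarrow> 'a \<Rightarrow> 'a set set" where
  "phi H a = {P \<in> irr_filters H. a \<in> P}"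

definition star :: "('a, 'm) hilbert_scheme \<Rightarrow> 'a set set heyting" where
  "star H = heyting_generated (upset_algebra (irr_filters H)) (phi H ` carrier H)"


section \<open>Coproducts\<close>

text \<open>
  The universal property quantifies over test objects \<open>Z\<close>, which in HOL live in a type.
  That type is made explicit by the first argument. It is immaterial as soon as it is large enough
  to hold the three algebras and what they freely generate: the property for the type of terms
  over the three carrier types implies the property for every type, see
  \<open>PHil0_coproduct_any_type\<close> and \<open>PHey_coproduct_any_type\<close> below.
\<close>

definition PHil0_coproduct :: "'z itself \<Rightarrow> 'a hilbert0 \<Rightarrow> 'b hilbert0 \<Rightarrow> 'c hilbert0 \<Rightarrow>
    ('a \<Rightarrow> 'c) \<Rightarrow> ('b \<Rightarrow> 'c) \<Rightarrow> bool" where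
  "PHil0_coproduct T H G K i j \<longleftrightarrow>
    PHil0 K \<and> i \<in> PHil0_hom H K \<and> j \<in> PHil0_hom G K \<and>
    (\<forall>(Z :: 'z hilbert0) f g. PHil0 Z \<and> f \<in> PHil0_hom H Z \<and> g \<in> PHil0_hom G Z \<longrightarrow>
      (\<exists>h \<in> PHil0_hom K Z.
        (\<forall>x \<in> carrier H. h (i x) = f x) \<and> (\<forall>y \<in> carrier G. h (j y) = g y) \<and>
        (\<forall>h' \<in> PHil0_hom K Z.
          (\<forall>x \<in> carrier H. h' (i x) = f x) \<and> (\<forall>y \<in> carrier G. h' (j y) = g y) \<longrightarrow>
          (\<forall>z \<in> carrier K. h' z = h z))))"

definition PHey_coproduct :: "'z itself \<Rightarrow> 'a heyting \<Rightarrow> 'b heyting \<Rightarrow> 'c heyting \<Rightarrow>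
    ('a \<Rightarrow> 'c) \<Rightarrow> ('b \<Rightarrow> 'c) \<Rightarrow> bool" where
  "PHey_coproduct T A B C i j \<longleftrightarrow>
    PHey C \<and> i \<in> PHey_hom A C \<and> j \<in> PHey_hom B C \<and>
    (\<forall>(Z :: 'z heyting) f g. PHey Z \<and> f \<in> PHey_hom A Z \<and> g \<in> PHey_hom B Z \<longrightarrow>
      (\<exists>h \<in> PHey_hom C Z.
        (\<forall>x \<in> carrier A. h (i x) = f x) \<and> (\<forall>y \<in> carrier B. h (j y) = g y) \<and>
        (\<forall>h' \<in> PHey_hom C Z.
          (\<forall>x \<in> carrier A. h' (i x) = f x) \<and> (\<forall>y \<in> carrier B. h' (j y) = g y) \<longrightarrow>
          (\<forall>z \<in> carrier C. h' z = h z))))"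


section \<open>Independence of the choice of types\<close>

subsection \<open>Hilbert algebras\<close>

lemma hilbert_eval_closed:
  assumes "one H \<in> S" "\<And>x y. x \<in> S \<Longrightarrow> y \<in> S \<Longrightarrow> imp H x y \<in> S" "range v \<subseteq> S"
  shows "hilbert_eval H v t \<in> S"
  using assms by (induction t) auto

locale hilbert_transport =
  fixes Z :: "('z, 'm) hilbert_scheme" and S :: "'z set" and e :: "'t \<Rightarrow> 'z"
    and Z' :: "('t, 'n) hilbert_scheme"
  assumes S_sub: "S \<subseteq> carrier Z" and S_one: "one Z \<in> S"
    and S_imp: "\<And>x y. x \<in> S \<Longrightarrow> y \<in> S \<Longrightarrow> imp Z x y \<in> S"
    and S_range: "S \<subseteq> range e"
    and car: "carrier Z' = inv e ` S"
    and imp': "\<And>x y. imp Z' x y = inv e (imp Z (e x) (e y))"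
    and one': "one Z' = inv e (one Z)"
begin

lemma e_inv: "x \<in> S \<Longrightarrow> e (inv e x) = x"
  using S_range by (auto simp: f_inv_into_f)

lemma e_car: "x \<in> carrier Z' \<Longrightarrow> e x \<in> S" 
  using car e_inv by auto

lemma e_imp: "x \<in> carrier Z' \<Longrightarrow> y \<in> carrier Z' \<Longrightarrow> e (imp Z' x y) = imp Z (e x) (e y)"
  using e_car e_inv S_imp imp' by metis

lemma e_one: "e (one Z') = one Z"
  using e_inv S_one one' by metis

lemma e_inj: "x \<in> carrier Z' \<Longrightarrow> y \<in> carrier Z' \<Longrightarrow> e x = e y \<Longrightarrow> x = y"
  using car e_inv by auto

lemma closed': "one Z' \<in> carrier Z'" "x \<in> carrier Z' \<Longrightarrow> y \<in> carrier Z' \<Longrightarrow> imp Z' x y \<in> carrier Z'"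
  using car one' imp' S_one S_imp e_car by auto

lemma e_eval: "range v \<subseteq> carrier Z' \<Longrightarrow> e (hilbert_eval Z' v t) = hilbert_eval Z (e \<circ> v) t"
proof (induction t)
  case (HImp s t)
  have "hilbert_eval Z' v s \<in> carrier Z'" "hilbert_eval Z' v t \<in> carrier Z'"
    using HImp.prems closed' by (auto intro!: hilbert_eval_closed)
  then show ?case using HImp by (simp add: e_imp)
qed (auto simp: e_one)

lemma inv_eval: "range v \<subseteq> S \<Longrightarrow> hilbert_eval Z v t = e (hilbert_eval Z' (inv e \<circ> v) t)"
proof -
  assume v: "range v \<subseteq> S"
  then have "range (inv e \<circ> v) \<subseteq> carrier Z'" using car by auto
  moreover have "e \<circ> (inv e \<circ> v) = v" using v by (auto simp: fun_eq_iff intro!: e_inv)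
  ultimately show ?thesis by (simp add: e_eval)
qed

lemma transfer_hilbert_algebra:
  assumes "hilbert_algebra Z" shows "hilbert_algebra Z'"
proof -
  interpret Z: hilbert_algebra Z by fact
  have c: "x \<in> carrier Z' \<Longrightarrow> e x \<in> carrier Z" for x using e_car S_sub by auto
  show ?thesis
  proof
    fix a b assume *: "a \<in> carrier Z'" "b \<in> carrier Z'"
    show "imp Z' a (imp Z' b a) = one Z'"
      by (rule e_inj) (use * in \<open>simp_all add: closed' e_imp e_one c Z.imp_K\<close>)
    assume "imp Z' a b = one Z'" "imp Z' b a = one Z'"
    then have "e (imp Z' a b) = e (one Z')" "e (imp Z' b a) = e (one Z')" by simp_all
    then have "e a = e b" using * c by (auto simp: e_imp e_one intro: Z.imp_antisym)
    then show "a = b" using * e_inj by blast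
  next
    fix a b d assume *: "a \<in> carrier Z'" "b \<in> carrier Z'" "d \<in> carrier Z'"
    show "imp Z' (imp Z' a (imp Z' b d)) (imp Z' (imp Z' a b) (imp Z' a d)) = one Z'"
      by (rule e_inj) (use * in \<open>simp_all add: closed' e_imp e_one c Z.imp_S\<close>)
  qed (use closed' in auto)
qed

lemma transfer_chain:
  assumes "hilbert_chain Z" shows "hilbert_chain Z'"
proof -
  interpret Z: hilbert_chain Z by fact
  interpret Z': hilbert_algebra Z' by (rule transfer_hilbert_algebra) unfold_locales
  show ?thesis
  proof
    fix a b assume *: "a \<in> carrier Z'" "b \<in> carrier Z'"
    then have "nat_le Z (e a) (e b) \<or> nat_le Z (e b) (e a)"
      using Z.total e_car S_sub by blast
    then have "e (imp Z' a b) = e (one Z') \<or> e (imp Z' b a) = e (one Z')"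
      using * by (simp add: nat_le_def e_imp e_one)
    then show "nat_le Z' a b \<or> nat_le Z' b a"
      unfolding nat_le_def using * e_inj closed' by blast
  qed
qed

lemma transfer_prelinear:
  assumes "prelinear_hilbert Z" shows "prelinear_hilbert Z'"
  unfolding prelinear_hilbert_def
proof (intro conjI allI impI)
  show "hilbert_algebra Z'" using assms transfer_hilbert_algebra prelinear_hilbert_def by blast
next
  fix s t assume "chain_identity s t"
  then have id: "hilbert_identity Z s t" using assms prelinear_hilbert_def by blast
  show "hilbert_identity Z' s t" unfolding hilbert_identity_def
  proof (intro allI impI)
    fix v :: "nat \<Rightarrow> 't" assume v: "range v \<subseteq> carrier Z'"
    then have "range (e \<circ> v) \<subseteq> carrier Z" using e_car S_sub by auto
    then have "e (hilbert_eval Z' v s) = e (hilbert_eval Z' v t)"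
      using id v by (simp add: e_eval hilbert_identity_def)
    then show "hilbert_eval Z' v s = hilbert_eval Z' v t"
      using v closed' by (auto intro!: e_inj hilbert_eval_closed)
  qed
qed

end

theorem hilbert_identity_all_chains:
  fixes K :: "('k, 'm) hilbert_scheme"
  assumes "hilbert_chain K" and st: "chain_identity s t"
  shows "hilbert_identity K s t"
  unfolding hilbert_identity_def
proof (intro allI impI)
  interpret K: hilbert_chain K by fact
  fix v :: "nat \<Rightarrow> 'k" assume v: "range v \<subseteq> carrier K"
  define S where "S = range (hilbert_eval K v)"
  define e :: "nat \<Rightarrow> 'k" where "e n = hilbert_eval K v (from_nat n)" for n
  define K' where "K' = \<lparr>carrier = inv e ` S, imp = (\<lambda>x y. inv e (imp K (e x) (e y))),
    one = inv e (one K)\<rparr>"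
  interpret hilbert_transport K S e K'
  proof
    show "S \<subseteq> carrier K" unfolding S_def
      using v by (auto intro!: hilbert_eval_closed K.one_closed K.imp_closed)
    show "one K \<in> S" unfolding S_def using rangeI[of "hilbert_eval K v" HOne] by simp
    fix x y assume "x \<in> S" "y \<in> S"
    then obtain a b where "x = hilbert_eval K v a" "y = hilbert_eval K v b"
      unfolding S_def by auto
    then show "imp K x y \<in> S" unfolding S_def using rangeI[of "hilbert_eval K v" "HImp a b"] by simp
  next
    show "S \<subseteq> range e"
    proof
      fix x assume "x \<in> S"
      then obtain a where "x = hilbert_eval K v a" unfolding S_def by auto
      then have "x = e (to_nat a)" by (simp add: e_def)
      then show "x \<in> range e" by simp
    qed
  qed (simp_all add: K'_def)
  have "hilbert_chain K'" using assms(1) by (rule transfer_chain)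
  then have id: "hilbert_identity K' s t" using st chain_identity_def by blast
  have vS: "range v \<subseteq> S"
  proof
    fix x assume "x \<in> range v"
    then obtain n where "x = hilbert_eval K v (HVar n)" by auto
    then show "x \<in> S" unfolding S_def by blast
  qed
  then have "range (inv e \<circ> v) \<subseteq> carrier K'" using car by auto
  then have "hilbert_eval K' (inv e \<circ> v) s = hilbert_eval K' (inv e \<circ> v) t"
    using id hilbert_identity_def by blast
  then show "hilbert_eval K v s = hilbert_eval K v t"
    using inv_eval[OF vS] by simp
qed

lemma PHil0_transport:
  fixes Z :: "'z hilbert0" and e :: "'t \<Rightarrow> 'z"
  assumes Z: "PHil0 Z" and S: "S \<subseteq> carrier Z" "one Z \<in> S" "zero Z \<in> S"
    "\<And>x y. x \<in> S \<Longrightarrow> y \<in> S \<Longrightarrow> imp Z x y \<in> S" "S \<subseteq> range e"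
  obtains Z' :: "'t hilbert0" where "PHil0 Z'" "e \<in> PHil0_hom Z' Z" "e ` carrier Z' = S"
    "inj_on e (carrier Z')"
proof -
  define Z' where "Z' = \<lparr>carrier = inv e ` S, imp = (\<lambda>x y. inv e (imp Z (e x) (e y))),
    one = inv e (one Z), zero = inv e (zero Z)\<rparr>"
  interpret hilbert_transport Z S e Z'
    using S by unfold_locales (simp_all add: Z'_def)
  have z: "zero Z' = inv e (zero Z)" by (simp add: Z'_def)
  have ez: "e (zero Z') = zero Z" using z S(3) e_inv by simp
  have zc: "zero Z' \<in> carrier Z'" using z car S(3) by simp
  have "imp Z' (zero Z') a = one Z'" if "a \<in> carrier Z'" for a
  proof (rule e_inj)
    show "e (imp Z' (zero Z') a) = e (one Z')"
      using that zc ez Z e_car S(1) by (auto simp: e_imp e_one PHil0_def nat_le_def)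
  qed (use that zc closed' in auto)
  then have P: "PHil0 Z'"
    using Z zc transfer_prelinear by (auto simp: PHil0_def nat_le_def)
  have h: "e \<in> PHil0_hom Z' Z"
    using e_car S(1) ez e_one e_imp by (auto simp: PHil0_hom_def)
  have im: "e ` carrier Z' = S" using car e_inv by (force simp: image_image)
  have inj: "inj_on e (carrier Z')" using e_inj by (auto simp: inj_on_def)
  show thesis by (rule that[OF P h im inj])
qed

lemma PHil0_closed:
  assumes "PHil0 Z"
  shows "one Z \<in> carrier Z" "zero Z \<in> carrier Z"
    "x \<in> carrier Z \<Longrightarrow> y \<in> carrier Z \<Longrightarrow> imp Z x y \<in> carrier Z"
  using assms by (auto simp: PHil0_def prelinear_hilbert_def hilbert_algebra_def)

lemma PHil0_hom_factor:
  assumes A: "PHil0 A" and Z': "PHil0 Z'" and e: "e \<in> PHil0_hom Z' Z" "inj_on e (carrier Z')"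
    and f: "f \<in> PHil0_hom A Z" "f ` carrier A \<subseteq> e ` carrier Z'"
  obtains f' where "f' \<in> PHil0_hom A Z'" "\<And>x. x \<in> carrier A \<Longrightarrow> e (f' x) = f x"
proof -
  define f' where "f' x = inv_into (carrier Z') e (f x)" for x
  have c: "f' x \<in> carrier Z'" "e (f' x) = f x" if "x \<in> carrier A" for x
    using that f(2) by (simp_all add: f'_def image_subset_iff inv_into_into f_inv_into_f)
  note cl = PHil0_closed[OF A] PHil0_closed[OF Z']
  have "f' (one A) = one Z'" "f' (zero A) = zero Z'"
    using e(1) f(1) c cl by (auto intro: inj_onD[OF e(2)] simp: PHil0_hom_def)
  moreover have "f' (imp A a b) = imp Z' (f' a) (f' b)" if "a \<in> carrier A" "b \<in> carrier A" for a b
    using e(1) f(1) c cl that by (intro inj_onD[OF e(2)]) (simp_all add: PHil0_hom_def)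
  ultimately have "f' \<in> PHil0_hom A Z'" using c by (auto simp: PHil0_hom_def)
  then show thesis using that c by blast
qed

lemma hilbert_span_sub:
  assumes "PHil0 Z" "S \<subseteq> carrier Z" shows "hilbert_span Z S \<subseteq> carrier Z"
proof
  fix x assume "x \<in> hilbert_span Z S"
  then show "x \<in> carrier Z"
    by induction (use assms PHil0_closed in auto)
qed

lemma PHil0_hom_comp: "f \<in> PHil0_hom A B \<Longrightarrow> g \<in> PHil0_hom B C \<Longrightarrow> g \<circ> f \<in> PHil0_hom A C"
  by (auto simp: PHil0_hom_def image_subset_iff)

lemma PHil0_hom_id: "id \<in> PHil0_hom A A"
  by (auto simp: PHil0_hom_def)

lemma PHil0_coproduct_generated:
  fixes H :: "'a hilbert0" and G :: "'b hilbert0" and K :: "'c hilbert0"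
  assumes H: "PHil0 H" and G: "PHil0 G"
    and co: "PHil0_coproduct TYPE(('a + 'b + 'c) hilbert_term) H G K i j"
  shows "carrier K = hilbert_span K (i ` carrier H \<union> j ` carrier G)"
proof -
  let ?S = "hilbert_span K (i ` carrier H \<union> j ` carrier G)"
  define e :: "('a + 'b + 'c) hilbert_term \<Rightarrow> 'c" where
    "e t = (case t of HVar (Inr (Inr c)) \<Rightarrow> c | _ \<Rightarrow> undefined)" for t
  have "x \<in> range e" for x using rangeI[of e "HVar (Inr (Inr x))"] by (simp add: e_def)
  then have e: "range e = UNIV" by auto
  have K: "PHil0 K" and i: "i \<in> PHil0_hom H K" and j: "j \<in> PHil0_hom G K"
    using co by (auto simp: PHil0_coproduct_def)
  have univ: "\<exists>h \<in> PHil0_hom K Z.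
        (\<forall>x \<in> carrier H. h (i x) = f x) \<and> (\<forall>y \<in> carrier G. h (j y) = g y) \<and>
        (\<forall>h' \<in> PHil0_hom K Z.
          (\<forall>x \<in> carrier H. h' (i x) = f x) \<and> (\<forall>y \<in> carrier G. h' (j y) = g y) \<longrightarrow>
          (\<forall>z \<in> carrier K. h' z = h z))"
    if "PHil0 Z" "f \<in> PHil0_hom H Z" "g \<in> PHil0_hom G Z"
    for Z :: "('a + 'b + 'c) hilbert_term hilbert0" and f g
    using co that unfolding PHil0_coproduct_def by blast
  have sub: "?S \<subseteq> carrier K" using i j by (intro hilbert_span_sub K) (auto simp: PHil0_hom_def)
  have "zero K = i (zero H)" using i by (auto simp: PHil0_hom_def)
  then have zS: "zero K \<in> ?S"
    using PHil0_closed(2)[OF H] by (auto intro!: hilbert_span.base)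
  obtain S' :: "('a + 'b + 'c) hilbert_term hilbert0" where
    S': "PHil0 S'" "e \<in> PHil0_hom S' K" "e ` carrier S' = ?S" "inj_on e (carrier S')"
    by (rule PHil0_transport[OF K sub, of e]) (use zS e in \<open>auto intro: hilbert_span.intros\<close>)
  obtain i' where i': "i' \<in> PHil0_hom H S'" "\<And>x. x \<in> carrier H \<Longrightarrow> e (i' x) = i x"
    by (rule PHil0_hom_factor[OF H S'(1,2,4) i]) (auto simp: S'(3) intro: hilbert_span.base)
  obtain j' where j': "j' \<in> PHil0_hom G S'" "\<And>x. x \<in> carrier G \<Longrightarrow> e (j' x) = j x"
    by (rule PHil0_hom_factor[OF G S'(1,2,4) j]) (auto simp: S'(3) intro: hilbert_span.base)
  obtain k where k: "k \<in> PHil0_hom K S'" "\<And>x. x \<in> carrier H \<Longrightarrow> k (i x) = i' x"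
    "\<And>x. x \<in> carrier G \<Longrightarrow> k (j x) = j' x"
    using univ[OF S'(1) i'(1) j'(1)] by blast
  define m where "m = e \<circ> k"
  have m: "m \<in> PHil0_hom K K" unfolding m_def by (rule PHil0_hom_comp[OF k(1) S'(2)])
  have mi: "\<And>x. x \<in> carrier H \<Longrightarrow> m (i x) = i x" "\<And>x. x \<in> carrier G \<Longrightarrow> m (j x) = j x"
    using i' j' k by (simp_all add: m_def)
  obtain K' :: "('a + 'b + 'c) hilbert_term hilbert0" where
    K': "PHil0 K'" "e \<in> PHil0_hom K' K" "e ` carrier K' = carrier K" "inj_on e (carrier K')"
    by (rule PHil0_transport[OF K order_refl, of e]) (use e PHil0_closed[OF K] in auto)
  obtain m' where m': "m' \<in> PHil0_hom K K'" "\<And>x. x \<in> carrier K \<Longrightarrow> e (m' x) = m x"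
    by (rule PHil0_hom_factor[OF K K'(1,2,4) m]) (use m in \<open>auto simp: K'(3) PHil0_hom_def\<close>)
  obtain d where d: "d \<in> PHil0_hom K K'" "\<And>x. x \<in> carrier K \<Longrightarrow> e (d x) = id x"
    by (rule PHil0_hom_factor[OF K K'(1,2,4) PHil0_hom_id]) (auto simp: K'(3))
  have c: "i x \<in> carrier K" "j y \<in> carrier K" if "x \<in> carrier H" "y \<in> carrier G" for x y
    using i j that by (auto simp: PHil0_hom_def)
  have "\<forall>x \<in> carrier H. m' (i x) = (d \<circ> i) x"
  proof
    fix x assume x: "x \<in> carrier H"
    then have "i x \<in> carrier K" using i by (auto simp: PHil0_hom_def)
    then show "m' (i x) = (d \<circ> i) x"
      using m' d mi x by (intro inj_onD[OF K'(4)]) (auto simp: PHil0_hom_def)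
  qed
  moreover have "\<forall>x \<in> carrier G. m' (j x) = (d \<circ> j) x"
  proof
    fix x assume x: "x \<in> carrier G"
    then have "j x \<in> carrier K" using j by (auto simp: PHil0_hom_def)
    then show "m' (j x) = (d \<circ> j) x"
      using m' d mi x by (intro inj_onD[OF K'(4)]) (auto simp: PHil0_hom_def)
  qed
  ultimately have "\<forall>z \<in> carrier K. m' z = d z"
    using univ[OF K'(1) PHil0_hom_comp[OF i d(1)] PHil0_hom_comp[OF j d(1)]] m'(1) d(1)
    by (metis comp_apply)
  then have "m z = z" if "z \<in> carrier K" for z using m' d that by (metis id_apply)
  moreover have "m z \<in> ?S" if "z \<in> carrier K" for z
    using k(1) S'(3) that by (auto simp: m_def PHil0_hom_def)
  ultimately show ?thesis using sub by force
qed

lemma PHil0_hom_eq_on_span: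
  assumes "PHil0 K" "S \<subseteq> carrier K" "h \<in> PHil0_hom K Z" "h' \<in> PHil0_hom K Z"
    and eq: "\<And>x. x \<in> S \<Longrightarrow> h' x = h x" and x: "x \<in> hilbert_span K S"
  shows "h' x = h x"
  using x
proof induction
  case (imp x y)
  then have "x \<in> carrier K" "y \<in> carrier K" using hilbert_span_sub assms(1,2) by blast+
  then show ?case using imp assms by (simp add: PHil0_hom_def)
qed (use assms in \<open>auto simp: PHil0_hom_def\<close>)

theorem PHil0_coproduct_any_type:
  fixes H :: "'a hilbert0" and G :: "'b hilbert0" and K :: "'c hilbert0"
  assumes H: "PHil0 H" and G: "PHil0 G"
    and co: "PHil0_coproduct TYPE(('a + 'b + 'c) hilbert_term) H G K i j"
  shows "PHil0_coproduct TYPE('z) H G K i j"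
proof -
  have K: "PHil0 K" and i: "i \<in> PHil0_hom H K" and j: "j \<in> PHil0_hom G K"
    using co by (auto simp: PHil0_coproduct_def)
  have sub: "i ` carrier H \<union> j ` carrier G \<subseteq> carrier K" using i j by (auto simp: PHil0_hom_def)
  have "\<exists>h \<in> PHil0_hom K Z.
        (\<forall>x \<in> carrier H. h (i x) = f x) \<and> (\<forall>y \<in> carrier G. h (j y) = g y) \<and>
        (\<forall>h' \<in> PHil0_hom K Z.
          (\<forall>x \<in> carrier H. h' (i x) = f x) \<and> (\<forall>y \<in> carrier G. h' (j y) = g y) \<longrightarrow>
          (\<forall>z \<in> carrier K. h' z = h z))"
    if Z: "PHil0 Z" and f: "f \<in> PHil0_hom H Z" and g: "g \<in> PHil0_hom G Z"
    for Z :: "'z hilbert0" and f g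
  proof -
    let ?S = "hilbert_span Z (f ` carrier H \<union> g ` carrier G)"
    define v :: "'a + 'b + 'c \<Rightarrow> 'z" where
      "v = case_sum f (case_sum g (\<lambda>_. undefined))"
    define e where "e = hilbert_eval Z v"
    have e: "?S \<subseteq> range e"
    proof
      fix x assume "x \<in> ?S"
      then show "x \<in> range e"
      proof induction
        case (base x)
        then obtain w where "x = v w" by (auto simp: v_def) (metis sum.case)+
        then show ?case using rangeI[of e "HVar w"] by (simp add: e_def)
      next
        case one
        show ?case using rangeI[of e HOne] by (simp add: e_def)
      next
        case (imp x y)
        then obtain s t where "x = e s" "y = e t" by auto
        then show ?case using rangeI[of e "HImp s t"] by (simp add: e_def)
      qed
    qed
    have sub': "?S \<subseteq> carrier Z" using f g by (intro hilbert_span_sub Z) (auto simp: PHil0_hom_def)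
    have "zero Z = f (zero H)" using f by (auto simp: PHil0_hom_def)
    then have zS: "zero Z \<in> ?S" using PHil0_closed(2)[OF H] by (auto intro!: hilbert_span.base)
    obtain S' :: "('a + 'b + 'c) hilbert_term hilbert0" where
      S': "PHil0 S'" "e \<in> PHil0_hom S' Z" "e ` carrier S' = ?S" "inj_on e (carrier S')"
      by (rule PHil0_transport[OF Z sub', of e]) (use zS e in \<open>auto intro: hilbert_span.intros\<close>)
    obtain f' where f': "f' \<in> PHil0_hom H S'" "\<And>x. x \<in> carrier H \<Longrightarrow> e (f' x) = f x"
      by (rule PHil0_hom_factor[OF H S'(1,2,4) f]) (auto simp: S'(3) intro: hilbert_span.base)
    obtain g' where g': "g' \<in> PHil0_hom G S'" "\<And>x. x \<in> carrier G \<Longrightarrow> e (g' x) = g x"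
      by (rule PHil0_hom_factor[OF G S'(1,2,4) g]) (auto simp: S'(3) intro: hilbert_span.base)
    obtain k where k: "k \<in> PHil0_hom K S'" "\<forall>x \<in> carrier H. k (i x) = f' x"
      "\<forall>x \<in> carrier G. k (j x) = g' x"
      using co S'(1) f'(1) g'(1) unfolding PHil0_coproduct_def by blast
    have "e \<circ> k \<in> PHil0_hom K Z" by (rule PHil0_hom_comp[OF k(1) S'(2)])
    moreover have "\<forall>x \<in> carrier H. (e \<circ> k) (i x) = f x" "\<forall>x \<in> carrier G. (e \<circ> k) (j x) = g x"
      using k f' g' by auto
    moreover have "\<forall>z \<in> carrier K. h' z = (e \<circ> k) z"
      if "h' \<in> PHil0_hom K Z" "\<forall>x \<in> carrier H. h' (i x) = f x" "\<forall>y \<in> carrier G. h' (j y) = g y" for h'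
    proof
      fix z assume "z \<in> carrier K"
      then show "h' z = (e \<circ> k) z"
        unfolding PHil0_coproduct_generated[OF H G co]
        by (rule PHil0_hom_eq_on_span[OF K sub calculation(1) that(1), rotated])
          (use calculation(2,3) that in auto)
    qed
    ultimately show ?thesis by blast
  qed
  then show ?thesis unfolding PHil0_coproduct_def using K i j by blast
qed


subsection \<open>Prelinear Heyting algebras\<close>

primrec heyting_eval :: "('a, 'm) heyting_scheme \<Rightarrow> ('v \<Rightarrow> 'a) \<Rightarrow> 'v heyting_term \<Rightarrow> 'a" where
  "heyting_eval A v (Var x) = v x"
| "heyting_eval A v One = one A"
| "heyting_eval A v Zero = zero A"
| "heyting_eval A v (Imp s t) = imp A (heyting_eval A v s) (heyting_eval A v t)"
| "heyting_eval A v (Meet s t) = meet A (heyting_eval A v s) (heyting_eval A v t)"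
| "heyting_eval A v (Join s t) = join A (heyting_eval A v s) (heyting_eval A v t)"

definition heyting_closed :: "('a, 'm) heyting_scheme \<Rightarrow> 'a set \<Rightarrow> bool" where
  "heyting_closed A S \<longleftrightarrow> one A \<in> S \<and> zero A \<in> S \<and>
    (\<forall>x \<in> S. \<forall>y \<in> S. imp A x y \<in> S \<and> meet A x y \<in> S \<and> join A x y \<in> S)"

lemma PHey_closed:
  assumes "PHey Z"
  shows "one Z \<in> carrier Z" "zero Z \<in> carrier Z"
    "x \<in> carrier Z \<Longrightarrow> y \<in> carrier Z \<Longrightarrow> imp Z x y \<in> carrier Z"
    "x \<in> carrier Z \<Longrightarrow> y \<in> carrier Z \<Longrightarrow> meet Z x y \<in> carrier Z"
    "x \<in> carrier Z \<Longrightarrow> y \<in> carrier Z \<Longrightarrow> join Z x y \<in> carrier Z"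
proof -
  interpret PHey Z by fact
  show "one Z \<in> carrier Z" "zero Z \<in> carrier Z"
    "x \<in> carrier Z \<Longrightarrow> y \<in> carrier Z \<Longrightarrow> imp Z x y \<in> carrier Z"
    "x \<in> carrier Z \<Longrightarrow> y \<in> carrier Z \<Longrightarrow> meet Z x y \<in> carrier Z"
    "x \<in> carrier Z \<Longrightarrow> y \<in> carrier Z \<Longrightarrow> join Z x y \<in> carrier Z"
    by (simp_all add: one_closed zero_closed imp_closed meet_closed join_closed)
qed

lemma heyting_closed_carrier: "PHey Z \<Longrightarrow> heyting_closed Z (carrier Z)"
  by (simp add: heyting_closed_def PHey_closed)

lemma heyting_closed_span: "heyting_closed Z (heyting_span Z S)"
  by (auto simp: heyting_closed_def intro: heyting_span.intros)

text \<open>A structure that embeds into an algebra of \<open>PHey\<close> belongs to \<open>PHey\<close>.\<close>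

lemma PHey_embedded:
  assumes Z: "PHey Z" and cl: "heyting_closed Z' (carrier Z')"
    and e: "e \<in> PHey_hom Z' Z" and inj: "inj_on e (carrier Z')"
  shows "PHey Z'"
proof -
  interpret Z: PHey Z by fact
  have c: "x \<in> carrier Z' \<Longrightarrow> e x \<in> carrier Z" for x using e by (auto simp: PHey_hom_def)
  have h: "e (one Z') = one Z" "e (zero Z') = zero Z"
    "a \<in> carrier Z' \<Longrightarrow> b \<in> carrier Z' \<Longrightarrow> e (imp Z' a b) = imp Z (e a) (e b)"
    "a \<in> carrier Z' \<Longrightarrow> b \<in> carrier Z' \<Longrightarrow> e (meet Z' a b) = meet Z (e a) (e b)"
    "a \<in> carrier Z' \<Longrightarrow> b \<in> carrier Z' \<Longrightarrow> e (join Z' a b) = join Z (e a) (e b)" for a b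
    using e by (auto simp: PHey_hom_def)
  have d: "one Z' \<in> carrier Z'" "zero Z' \<in> carrier Z'"
    "a \<in> carrier Z' \<Longrightarrow> b \<in> carrier Z' \<Longrightarrow> imp Z' a b \<in> carrier Z'"
    "a \<in> carrier Z' \<Longrightarrow> b \<in> carrier Z' \<Longrightarrow> meet Z' a b \<in> carrier Z'"
    "a \<in> carrier Z' \<Longrightarrow> b \<in> carrier Z' \<Longrightarrow> join Z' a b \<in> carrier Z'" for a b
    using cl by (auto simp: heyting_closed_def)
  have i: "x = y" if "e x = e y" "x \<in> carrier Z'" "y \<in> carrier Z'" for x y
    using inj that by (auto dest: inj_onD)
  show ?thesis
  proof
    fix a b assume "a \<in> carrier Z'" "b \<in> carrier Z'"
    note * = this c[OF this(1)] c[OF this(2)]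
    show "meet Z' a b = meet Z' b a" "join Z' a b = join Z' b a"
      by (rule i; simp add: * h d Z.meet_comm[of "e a" "e b"] Z.join_comm[of "e a" "e b"])+
    show "meet Z' a (join Z' a b) = a" "join Z' a (meet Z' a b) = a"
      "join Z' (imp Z' a b) (imp Z' b a) = one Z'"
      by (rule i; simp add: * h d Z.meet_absorb Z.join_absorb Z.prelinear)+
  next
    fix a b c' assume "a \<in> carrier Z'" "b \<in> carrier Z'" "c' \<in> carrier Z'"
    note * = this c[OF this(1)] c[OF this(2)] c[OF this(3)]
    show "meet Z' (meet Z' a b) c' = meet Z' a (meet Z' b c')"
      "join Z' (join Z' a b) c' = join Z' a (join Z' b c')"
      by (rule i; simp add: * h d Z.meet_assoc Z.join_assoc)+
    have "meet Z' (meet Z' a b) c' = meet Z' a b \<longleftrightarrow>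
        e (meet Z' (meet Z' a b) c') = e (meet Z' a b)"
      using i * d by metis
    also have "\<dots> \<longleftrightarrow> e (meet Z' a (imp Z' b c')) = e a"
      by (simp add: * h d Z.residuation)
    also have "\<dots> \<longleftrightarrow> meet Z' a (imp Z' b c') = a"
      using i * d by metis
    finally show "meet Z' (meet Z' a b) c' = meet Z' a b \<longleftrightarrow> meet Z' a (imp Z' b c') = a" .
  next
    fix a assume "a \<in> carrier Z'"
    note * = this c[OF this(1)]
    show "meet Z' a (one Z') = a" "join Z' a (zero Z') = a"
      by (rule i; simp add: * h d Z.meet_one Z.join_zero)+
  qed (simp_all add: d)
qed

lemma PHey_transport:
  fixes Z :: "'z heyting" and e :: "'t \<Rightarrow> 'z"
  assumes Z: "PHey Z" and S: "S \<subseteq> carrier Z" "heyting_closed Z S" "S \<subseteq> range e"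
  obtains Z' :: "'t heyting" where "PHey Z'" "e \<in> PHey_hom Z' Z" "e ` carrier Z' = S"
    "inj_on e (carrier Z')"
proof -
  define Z' where "Z' = \<lparr>carrier = inv e ` S, imp = (\<lambda>x y. inv e (imp Z (e x) (e y))),
    one = inv e (one Z), zero = inv e (zero Z), meet = (\<lambda>x y. inv e (meet Z (e x) (e y))),
    join = (\<lambda>x y. inv e (join Z (e x) (e y)))\<rparr>"
  have ei: "e (inv e x) = x" if "x \<in> S" for x using S(3) that by (auto simp: f_inv_into_f)
  have ec: "e x \<in> S" if "x \<in> carrier Z'" for x using that ei by (auto simp: Z'_def)
  have h: "e \<in> PHey_hom Z' Z"
    using S(1,2) ei ec by (auto simp: PHey_hom_def heyting_closed_def Z'_def)
  have im: "e ` carrier Z' = S" using ei by (force simp: image_image Z'_def)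
  have inj: "inj_on e (carrier Z')" using ei by (auto simp: inj_on_def Z'_def)
  have cl: "heyting_closed Z' (carrier Z')"
    using S(2) ei by (auto simp: heyting_closed_def Z'_def)
  show thesis by (rule that[OF PHey_embedded[OF Z cl h inj] h im inj])
qed

lemma PHey_hom_factor:
  assumes A: "PHey A" and Z': "PHey Z'" and e: "e \<in> PHey_hom Z' Z" "inj_on e (carrier Z')"
    and f: "f \<in> PHey_hom A Z" "f ` carrier A \<subseteq> e ` carrier Z'"
  obtains f' where "f' \<in> PHey_hom A Z'" "\<And>x. x \<in> carrier A \<Longrightarrow> e (f' x) = f x"
proof -
  define f' where "f' x = inv_into (carrier Z') e (f x)" for x
  have c: "f' x \<in> carrier Z'" "e (f' x) = f x" if "x \<in> carrier A" for x
    using that f(2) by (simp_all add: f'_def image_subset_iff inv_into_into f_inv_into_f)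
  note cl = PHey_closed[OF A] PHey_closed[OF Z']
  have "f' (one A) = one Z'" "f' (zero A) = zero Z'"
    using e(1) f(1) c cl by (auto intro: inj_onD[OF e(2)] simp: PHey_hom_def)
  moreover have "f' (imp A a b) = imp Z' (f' a) (f' b)" "f' (meet A a b) = meet Z' (f' a) (f' b)"
    "f' (join A a b) = join Z' (f' a) (f' b)"
    if "a \<in> carrier A" "b \<in> carrier A" for a b
    using e(1) f(1) c cl that by (intro inj_onD[OF e(2)]; simp add: PHey_hom_def)+
  ultimately have "f' \<in> PHey_hom A Z'" using c by (auto simp: PHey_hom_def)
  then show thesis using that c by blast
qed

lemma heyting_span_sub:
  assumes "PHey Z" "S \<subseteq> carrier Z" shows "heyting_span Z S \<subseteq> carrier Z"
proof
  fix x assume "x \<in> heyting_span Z S"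
  then show "x \<in> carrier Z"
    by induction (use assms PHey_closed in auto)
qed

lemma heyting_span_eval:
  "heyting_span Z (f ` X \<union> g ` Y) \<subseteq> range (heyting_eval Z (case_sum f g))"
proof
  fix x assume "x \<in> heyting_span Z (f ` X \<union> g ` Y)"
  then show "x \<in> range (heyting_eval Z (case_sum f g))" (is "_ \<in> range ?e")
  proof induction
    case (base x)
    then obtain w where "x = case_sum f g w" by (metis Un_iff imageE sum.case)
    then show ?case using rangeI[of ?e "Var w"] by simp
  next
    case one
    show ?case using rangeI[of ?e One] by simp
  next
    case zero
    show ?case using rangeI[of ?e Zero] by simp
  next
    case (imp x y)
    then obtain s t where "x = ?e s" "y = ?e t" by auto
    then show ?case using rangeI[of ?e "Imp s t"] by simp
  next
    case (meet x y)
    then obtain s t where "x = ?e s" "y = ?e t" by auto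
    then show ?case using rangeI[of ?e "Meet s t"] by simp
  next
    case (join x y)
    then obtain s t where "x = ?e s" "y = ?e t" by auto
    then show ?case using rangeI[of ?e "Join s t"] by simp
  qed
qed

lemma PHey_hom_comp: "f \<in> PHey_hom A B \<Longrightarrow> g \<in> PHey_hom B D \<Longrightarrow> g \<circ> f \<in> PHey_hom A D"
  by (auto simp: PHey_hom_def image_subset_iff)

lemma PHey_hom_id: "id \<in> PHey_hom A A"
  by (auto simp: PHey_hom_def)

lemma PHey_coproduct_generated:
  fixes A :: "'a heyting" and B :: "'b heyting" and C :: "'c heyting"
  assumes A: "PHey A" and B: "PHey B"
    and co: "PHey_coproduct TYPE(('a + 'b + 'c) heyting_term) A B C i j"
  shows "carrier C = heyting_span C (i ` carrier A \<union> j ` carrier B)"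
proof -
  let ?S = "heyting_span C (i ` carrier A \<union> j ` carrier B)"
  define e :: "('a + 'b + 'c) heyting_term \<Rightarrow> 'c" where
    "e t = (case t of Var (Inr (Inr c)) \<Rightarrow> c | _ \<Rightarrow> undefined)" for t
  have "x \<in> range e" for x using rangeI[of e "Var (Inr (Inr x))"] by (simp add: e_def)
  then have e: "range e = UNIV" by auto
  have C: "PHey C" and i: "i \<in> PHey_hom A C" and j: "j \<in> PHey_hom B C"
    using co by (auto simp: PHey_coproduct_def)
  have univ: "\<exists>h \<in> PHey_hom C Z.
        (\<forall>x \<in> carrier A. h (i x) = f x) \<and> (\<forall>y \<in> carrier B. h (j y) = g y) \<and>
        (\<forall>h' \<in> PHey_hom C Z.
          (\<forall>x \<in> carrier A. h' (i x) = f x) \<and> (\<forall>y \<in> carrier B. h' (j y) = g y) \<longrightarrow>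
          (\<forall>z \<in> carrier C. h' z = h z))"
    if "PHey Z" "f \<in> PHey_hom A Z" "g \<in> PHey_hom B Z"
    for Z :: "('a + 'b + 'c) heyting_term heyting" and f g
    using co that unfolding PHey_coproduct_def by blast
  have sub: "?S \<subseteq> carrier C" using i j by (intro heyting_span_sub C) (auto simp: PHey_hom_def)
  obtain S' :: "('a + 'b + 'c) heyting_term heyting" where
    S': "PHey S'" "e \<in> PHey_hom S' C" "e ` carrier S' = ?S" "inj_on e (carrier S')"
    by (rule PHey_transport[OF C sub, of e]) (simp_all add: e heyting_closed_span)
  obtain i' where i': "i' \<in> PHey_hom A S'" "\<And>x. x \<in> carrier A \<Longrightarrow> e (i' x) = i x"
    by (rule PHey_hom_factor[OF A S'(1,2,4) i]) (auto simp: S'(3) intro: heyting_span.base)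
  obtain j' where j': "j' \<in> PHey_hom B S'" "\<And>x. x \<in> carrier B \<Longrightarrow> e (j' x) = j x"
    by (rule PHey_hom_factor[OF B S'(1,2,4) j]) (auto simp: S'(3) intro: heyting_span.base)
  obtain k where k: "k \<in> PHey_hom C S'" "\<And>x. x \<in> carrier A \<Longrightarrow> k (i x) = i' x"
    "\<And>x. x \<in> carrier B \<Longrightarrow> k (j x) = j' x"
    using univ[OF S'(1) i'(1) j'(1)] by blast
  define m where "m = e \<circ> k"
  have m: "m \<in> PHey_hom C C" unfolding m_def by (rule PHey_hom_comp[OF k(1) S'(2)])
  have mi: "\<And>x. x \<in> carrier A \<Longrightarrow> m (i x) = i x" "\<And>x. x \<in> carrier B \<Longrightarrow> m (j x) = j x"
    using i' j' k by (simp_all add: m_def)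
  obtain C1 :: "('a + 'b + 'c) heyting_term heyting" where
    C1: "PHey C1" "e \<in> PHey_hom C1 C" "e ` carrier C1 = carrier C" "inj_on e (carrier C1)"
    by (rule PHey_transport[OF C order_refl, of e]) (simp_all add: e heyting_closed_carrier C)
  obtain m' where m': "m' \<in> PHey_hom C C1" "\<And>x. x \<in> carrier C \<Longrightarrow> e (m' x) = m x"
    by (rule PHey_hom_factor[OF C C1(1,2,4) m]) (use m in \<open>auto simp: C1(3) PHey_hom_def\<close>)
  obtain d where d: "d \<in> PHey_hom C C1" "\<And>x. x \<in> carrier C \<Longrightarrow> e (d x) = id x"
    by (rule PHey_hom_factor[OF C C1(1,2,4) PHey_hom_id]) (auto simp: C1(3))
  have c: "i x \<in> carrier C" "j y \<in> carrier C" if "x \<in> carrier A" "y \<in> carrier B" for x y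
    using i j that by (auto simp: PHey_hom_def)
  have "\<forall>x \<in> carrier A. m' (i x) = (d \<circ> i) x"
  proof
    fix x assume x: "x \<in> carrier A"
    then have "i x \<in> carrier C" using i by (auto simp: PHey_hom_def)
    then show "m' (i x) = (d \<circ> i) x"
      using m' d mi x by (intro inj_onD[OF C1(4)]) (auto simp: PHey_hom_def)
  qed
  moreover have "\<forall>x \<in> carrier B. m' (j x) = (d \<circ> j) x"
  proof
    fix x assume x: "x \<in> carrier B"
    then have "j x \<in> carrier C" using j by (auto simp: PHey_hom_def)
    then show "m' (j x) = (d \<circ> j) x"
      using m' d mi x by (intro inj_onD[OF C1(4)]) (auto simp: PHey_hom_def)
  qed
  ultimately have "\<forall>z \<in> carrier C. m' z = d z"
    using univ[OF C1(1) PHey_hom_comp[OF i d(1)] PHey_hom_comp[OF j d(1)]] m'(1) d(1)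
    by (metis comp_apply)
  then have "m z = z" if "z \<in> carrier C" for z using m' d that by (metis id_apply)
  moreover have "m z \<in> ?S" if "z \<in> carrier C" for z
    using k(1) S'(3) that by (auto simp: m_def PHey_hom_def)
  ultimately show ?thesis using sub by force
qed

lemma PHey_hom_eq_on_span:
  assumes "PHey C" "S \<subseteq> carrier C" "h \<in> PHey_hom C Z" "h' \<in> PHey_hom C Z"
    and eq: "\<And>x. x \<in> S \<Longrightarrow> h' x = h x" and x: "x \<in> heyting_span C S"
  shows "h' x = h x"
  using x
proof induction
  case (imp x y)
  then have "x \<in> carrier C" "y \<in> carrier C" using heyting_span_sub assms(1,2) by blast+
  then show ?case using imp assms by (simp add: PHey_hom_def)
next
  case (meet x y)
  then have "x \<in> carrier C" "y \<in> carrier C" using heyting_span_sub assms(1,2) by blast+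
  then show ?case using meet assms by (simp add: PHey_hom_def)
next
  case (join x y)
  then have "x \<in> carrier C" "y \<in> carrier C" using heyting_span_sub assms(1,2) by blast+
  then show ?case using join assms by (simp add: PHey_hom_def)
qed (use assms in \<open>auto simp: PHey_hom_def\<close>)

theorem PHey_coproduct_any_type:
  fixes A :: "'a heyting" and B :: "'b heyting" and C :: "'c heyting"
  assumes A: "PHey A" and B: "PHey B"
    and co: "PHey_coproduct TYPE(('a + 'b + 'c) heyting_term) A B C i j"
  shows "PHey_coproduct TYPE('z) A B C i j"
proof -
  have C: "PHey C" and i: "i \<in> PHey_hom A C" and j: "j \<in> PHey_hom B C"
    using co by (auto simp: PHey_coproduct_def)
  have sub: "i ` carrier A \<union> j ` carrier B \<subseteq> carrier C" using i j by (auto simp: PHey_hom_def)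
  have "\<exists>h \<in> PHey_hom C Z.
        (\<forall>x \<in> carrier A. h (i x) = f x) \<and> (\<forall>y \<in> carrier B. h (j y) = g y) \<and>
        (\<forall>h' \<in> PHey_hom C Z.
          (\<forall>x \<in> carrier A. h' (i x) = f x) \<and> (\<forall>y \<in> carrier B. h' (j y) = g y) \<longrightarrow>
          (\<forall>z \<in> carrier C. h' z = h z))"
    if Z: "PHey Z" and f: "f \<in> PHey_hom A Z" and g: "g \<in> PHey_hom B Z"
    for Z :: "'z heyting" and f g
  proof -
    let ?S = "heyting_span Z (f ` carrier A \<union> g ` carrier B)"
    define e :: "('a + 'b + 'c) heyting_term \<Rightarrow> 'z" where
      "e = heyting_eval Z (case_sum f (case_sum g (\<lambda>_. undefined)))"
    have e: "?S \<subseteq> range e"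
      using heyting_span_eval[of Z f "carrier A" "case_sum g (\<lambda>_ :: 'c. undefined)" "Inl ` carrier B"]
      by (simp add: image_image e_def)
    have sub': "?S \<subseteq> carrier Z" using f g by (intro heyting_span_sub Z) (auto simp: PHey_hom_def)
    obtain S' :: "('a + 'b + 'c) heyting_term heyting" where
      S': "PHey S'" "e \<in> PHey_hom S' Z" "e ` carrier S' = ?S" "inj_on e (carrier S')"
      by (rule PHey_transport[OF Z sub', of e]) (simp_all add: e heyting_closed_span)
    obtain f' where f': "f' \<in> PHey_hom A S'" "\<And>x. x \<in> carrier A \<Longrightarrow> e (f' x) = f x"
      by (rule PHey_hom_factor[OF A S'(1,2,4) f]) (auto simp: S'(3) intro: heyting_span.base)
    obtain g' where g': "g' \<in> PHey_hom B S'" "\<And>x. x \<in> carrier B \<Longrightarrow> e (g' x) = g x"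
      by (rule PHey_hom_factor[OF B S'(1,2,4) g]) (auto simp: S'(3) intro: heyting_span.base)
    obtain k where k: "k \<in> PHey_hom C S'" "\<forall>x \<in> carrier A. k (i x) = f' x"
      "\<forall>x \<in> carrier B. k (j x) = g' x"
      using co S'(1) f'(1) g'(1) unfolding PHey_coproduct_def by blast
    have "e \<circ> k \<in> PHey_hom C Z" by (rule PHey_hom_comp[OF k(1) S'(2)])
    moreover have "\<forall>x \<in> carrier A. (e \<circ> k) (i x) = f x" "\<forall>x \<in> carrier B. (e \<circ> k) (j x) = g x"
      using k f' g' by auto
    moreover have "\<forall>z \<in> carrier C. h' z = (e \<circ> k) z"
      if "h' \<in> PHey_hom C Z" "\<forall>x \<in> carrier A. h' (i x) = f x" "\<forall>y \<in> carrier B. h' (j y) = g y" for h'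
    proof
      fix z assume "z \<in> carrier C"
      then show "h' z = (e \<circ> k) z"
        unfolding PHey_coproduct_generated[OF A B co]
        by (rule PHey_hom_eq_on_span[OF C sub calculation(1) that(1), rotated])
          (use calculation(2,3) that in auto)
    qed
    ultimately show ?thesis by blast
  qed
  then show ?thesis unfolding PHey_coproduct_def using C i j by blast
qed


text \<open>Coproducts in \<open>PHey\<close> exist: as a subalgebra of a product of test objects.\<close>

definition heyting_product :: "'i set \<Rightarrow> ('i \<Rightarrow> 't heyting) \<Rightarrow> ('i \<Rightarrow> 't) heyting" where
  "heyting_product I F =
    \<lparr>carrier = {p. (\<forall>i \<in> I. p i \<in> carrier (F i)) \<and> (\<forall>i. i \<notin> I \<longrightarrow> p i = undefined)},
     imp = (\<lambda>p q i. if i \<in> I then imp (F i) (p i) (q i) else undefined),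
     one = (\<lambda>i. if i \<in> I then one (F i) else undefined),
     zero = (\<lambda>i. if i \<in> I then zero (F i) else undefined),
     meet = (\<lambda>p q i. if i \<in> I then meet (F i) (p i) (q i) else undefined),
     join = (\<lambda>p q i. if i \<in> I then join (F i) (p i) (q i) else undefined)\<rparr>"

lemma PHey_product:
  assumes F: "\<And>i. i \<in> I \<Longrightarrow> PHey (F i)"
  shows "PHey (heyting_product I F)" (is "PHey ?P")
proof -
  have h: "heyting_algebra (F i)" if "i \<in> I" for i using F[OF that] by (simp add: PHey_def)
  have c: "p i \<in> carrier (F i)" if "p \<in> carrier ?P" "i \<in> I" for p i
    using that by (simp add: heyting_product_def)
  have eqI: "p = q"
    if "p \<in> carrier ?P" "q \<in> carrier ?P" "\<And>i. i \<in> I \<Longrightarrow> p i = q i" for p q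
  proof
    fix i show "p i = q i"
      using that by (cases "i \<in> I") (simp_all add: heyting_product_def)
  qed
  have ops: "one ?P i = one (F i)" "zero ?P i = zero (F i)"
    "imp ?P p q i = imp (F i) (p i) (q i)" "meet ?P p q i = meet (F i) (p i) (q i)"
    "join ?P p q i = join (F i) (p i) (q i)" if "i \<in> I" for i p q
    using that by (simp_all add: heyting_product_def)
  have cl: "one ?P \<in> carrier ?P" "zero ?P \<in> carrier ?P"
    "p \<in> carrier ?P \<Longrightarrow> q \<in> carrier ?P \<Longrightarrow> imp ?P p q \<in> carrier ?P"
    "p \<in> carrier ?P \<Longrightarrow> q \<in> carrier ?P \<Longrightarrow> meet ?P p q \<in> carrier ?P"
    "p \<in> carrier ?P \<Longrightarrow> q \<in> carrier ?P \<Longrightarrow> join ?P p q \<in> carrier ?P" for p q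
    using F by (simp_all add: heyting_product_def PHey_closed)
  show ?thesis
  proof
    fix a b assume ab: "a \<in> carrier ?P" "b \<in> carrier ?P"
    show "meet ?P a b = meet ?P b a"
    proof (rule eqI)
      fix i assume i: "i \<in> I"
      show "meet ?P a b i = meet ?P b a i"
        unfolding ops[OF i] by (intro heyting_algebra.meet_comm h c ab i)
    qed (simp_all add: ab cl)
    show "join ?P a b = join ?P b a"
    proof (rule eqI)
      fix i assume i: "i \<in> I"
      show "join ?P a b i = join ?P b a i"
        unfolding ops[OF i] by (intro heyting_algebra.join_comm h c ab i)
    qed (simp_all add: ab cl)
    show "meet ?P a (join ?P a b) = a"
      by (rule eqI) (use ab in \<open>simp_all add: cl ops c heyting_algebra.meet_absorb[OF h]\<close>)
    show "join ?P a (meet ?P a b) = a"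
      by (rule eqI) (use ab in \<open>simp_all add: cl ops c heyting_algebra.join_absorb[OF h]\<close>)
    show "join ?P (imp ?P a b) (imp ?P b a) = one ?P"
      by (rule eqI) (use ab in \<open>simp_all add: cl ops c PHey.prelinear[OF F]\<close>)
  next
    fix a b d assume abd: "a \<in> carrier ?P" "b \<in> carrier ?P" "d \<in> carrier ?P"
    show "meet ?P (meet ?P a b) d = meet ?P a (meet ?P b d)"
      by (rule eqI) (use abd in \<open>simp_all add: cl ops c heyting_algebra.meet_assoc[OF h]\<close>)
    show "join ?P (join ?P a b) d = join ?P a (join ?P b d)"
      by (rule eqI) (use abd in \<open>simp_all add: cl ops c heyting_algebra.join_assoc[OF h]\<close>)
    have eq_iff: "p = q \<longleftrightarrow> (\<forall>i \<in> I. p i = q i)" if "p \<in> carrier ?P" "q \<in> carrier ?P" for p q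
      using eqI[OF that] by auto
    show "meet ?P (meet ?P a b) d = meet ?P a b \<longleftrightarrow> meet ?P a (imp ?P b d) = a"
      using abd by (simp add: eq_iff cl) (simp add: ops c heyting_algebra.residuation[OF h])
  next
    fix a assume a: "a \<in> carrier ?P"
    show "meet ?P a (one ?P) = a"
      by (rule eqI) (use a in \<open>simp_all add: cl ops c heyting_algebra.meet_one[OF h]\<close>)
    show "join ?P a (zero ?P) = a"
      by (rule eqI) (use a in \<open>simp_all add: cl ops c heyting_algebra.join_zero[OF h]\<close>)
  qed (simp_all add: cl)
qed

theorem PHey_coproduct_exists:
  fixes A :: "'a heyting" and B :: "'b heyting"
  assumes A: "PHey A" and B: "PHey B"
  shows "\<exists>(C :: (('a + 'b) heyting_term heyting \<times> ('a \<Rightarrow> ('a + 'b) heyting_term) \<times>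
      ('b \<Rightarrow> ('a + 'b) heyting_term) \<Rightarrow> ('a + 'b) heyting_term) heyting) i j.
    PHey_coproduct TYPE('z) A B C i j"
proof -
  define I where "I = {(S :: ('a + 'b) heyting_term heyting, f, g).
    PHey S \<and> f \<in> PHey_hom A S \<and> g \<in> PHey_hom B S}"
  define P where "P = heyting_product I fst"
  define i where "i x = (\<lambda>w. if w \<in> I then fst (snd w) x else undefined)" for x
  define j where "j x = (\<lambda>w. if w \<in> I then snd (snd w) x else undefined)" for x
  have fA: "fst (snd w) \<in> PHey_hom A (fst w)" if "w \<in> I" for w using that by (auto simp: I_def)
  have gB: "snd (snd w) \<in> PHey_hom B (fst w)" if "w \<in> I" for w using that by (auto simp: I_def)
  let ?G = "i ` carrier A \<union> j ` carrier B"
  define C where "C = heyting_generated P ?G"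
  have P: "PHey P" unfolding P_def by (rule PHey_product) (auto simp: I_def)
  have iP: "i \<in> PHey_hom A P"
    using fA by (fastforce simp: PHey_hom_def P_def heyting_product_def i_def fun_eq_iff)
  have jP: "j \<in> PHey_hom B P"
    using gB by (fastforce simp: PHey_hom_def P_def heyting_product_def j_def fun_eq_iff)
  have GP: "?G \<subseteq> carrier P" using iP jP by (auto simp: PHey_hom_def)
  have Csub: "carrier C \<subseteq> carrier P" and cl: "heyting_closed C (carrier C)"
    using heyting_span_sub[OF P GP] heyting_closed_span[of P ?G]
    by (simp_all add: C_def heyting_generated_def heyting_closed_def)
  have inc: "id \<in> PHey_hom C P"
    using Csub by (auto simp: PHey_hom_def C_def heyting_generated_def)
  have C: "PHey C" by (rule PHey_embedded[OF P cl inc]) simp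
  have i: "i \<in> PHey_hom A C" and j: "j \<in> PHey_hom B C"
    using iP jP by (auto simp: PHey_hom_def C_def heyting_generated_def intro: heyting_span.base)
  have gen: "carrier C = heyting_span C ?G"
  proof -
    have "x \<in> heyting_span C ?G" if "x \<in> heyting_span P ?G" for x
      using that
    proof induction
      case one
      show ?case using heyting_span.one[of C ?G] by (simp add: C_def heyting_generated_def)
    next
      case zero
      show ?case using heyting_span.zero[of C ?G] by (simp add: C_def heyting_generated_def)
    next
      case (imp x y)
      then show ?case using heyting_span.imp[of x C ?G y] by (simp add: C_def heyting_generated_def)
    next
      case (meet x y)
      then show ?case using heyting_span.meet[of x C ?G y] by (simp add: C_def heyting_generated_def)
    next
      case (join x y)
      then show ?case using heyting_span.join[of x C ?G y] by (simp add: C_def heyting_generated_def)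
    qed (rule heyting_span.base)
    moreover have "?G \<subseteq> carrier C" using i j by (auto simp: PHey_hom_def)
    moreover have "carrier C = heyting_span P ?G" by (simp add: C_def heyting_generated_def)
    ultimately show ?thesis using heyting_span_sub[OF C, of ?G] by blast
  qed
  have sub: "?G \<subseteq> carrier C" using i j by (auto simp: PHey_hom_def)
  have "\<exists>h \<in> PHey_hom C Z.
        (\<forall>x \<in> carrier A. h (i x) = f x) \<and> (\<forall>y \<in> carrier B. h (j y) = g y) \<and>
        (\<forall>h' \<in> PHey_hom C Z.
          (\<forall>x \<in> carrier A. h' (i x) = f x) \<and> (\<forall>y \<in> carrier B. h' (j y) = g y) \<longrightarrow>
          (\<forall>z \<in> carrier C. h' z = h z))"
    if Z: "PHey Z" and f: "f \<in> PHey_hom A Z" and g: "g \<in> PHey_hom B Z"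
    for Z :: "'z heyting" and f g
  proof -
    let ?S = "heyting_span Z (f ` carrier A \<union> g ` carrier B)"
    obtain e :: "('a + 'b) heyting_term \<Rightarrow> 'z" where e: "?S \<subseteq> range e"
      using heyting_span_eval[of Z f "carrier A" g "carrier B"] by blast
    have sub': "?S \<subseteq> carrier Z" using f g by (intro heyting_span_sub Z) (auto simp: PHey_hom_def)
    obtain S' :: "('a + 'b) heyting_term heyting" where
      S': "PHey S'" "e \<in> PHey_hom S' Z" "e ` carrier S' = ?S" "inj_on e (carrier S')"
      by (rule PHey_transport[OF Z sub', of e]) (simp_all add: e heyting_closed_span)
    obtain f' where f': "f' \<in> PHey_hom A S'" "\<And>x. x \<in> carrier A \<Longrightarrow> e (f' x) = f x"
      by (rule PHey_hom_factor[OF A S'(1,2,4) f]) (auto simp: S'(3) intro: heyting_span.base)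
    obtain g' where g': "g' \<in> PHey_hom B S'" "\<And>x. x \<in> carrier B \<Longrightarrow> e (g' x) = g x"
      by (rule PHey_hom_factor[OF B S'(1,2,4) g]) (auto simp: S'(3) intro: heyting_span.base)
    have I: "(S', f', g') \<in> I" using S'(1) f'(1) g'(1) by (simp add: I_def)
    define k where "k p = p (S', f', g')" for p :: "_ \<Rightarrow> ('a + 'b) heyting_term"
    have "k \<in> PHey_hom P S'"
      using I by (auto simp: PHey_hom_def P_def heyting_product_def k_def)
    then have k: "k \<in> PHey_hom C S'" using PHey_hom_comp[OF inc] by fastforce
    have "e \<circ> k \<in> PHey_hom C Z" by (rule PHey_hom_comp[OF k(1) S'(2)])
    moreover have "\<forall>x \<in> carrier A. (e \<circ> k) (i x) = f x" "\<forall>x \<in> carrier B. (e \<circ> k) (j x) = g x"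
      using I f' g' by (auto simp: k_def i_def j_def)
    moreover have "\<forall>z \<in> carrier C. h' z = (e \<circ> k) z"
      if "h' \<in> PHey_hom C Z" "\<forall>x \<in> carrier A. h' (i x) = f x" "\<forall>y \<in> carrier B. h' (j y) = g y" for h'
    proof
      fix z assume "z \<in> carrier C"
      then have "z \<in> heyting_span C ?G" using gen by simp
      then show "h' z = (e \<circ> k) z"
        by (rule PHey_hom_eq_on_span[OF C sub calculation(1) that(1), rotated])
          (use calculation(2,3) that in auto)
    qed
    ultimately show ?thesis by blast
  qed
  then show ?thesis unfolding PHey_coproduct_def using C i j by blast
qed

end

theory Submission
  imports Defs
begin

text \<open>
  The construction rests on two facts about the embedding \<open>\<phi>\<close>. First, \<open>star\<close> is a functor
  and \<open>\<phi>\<close> is natural: a homomorphism \<open>f : H \<rightarrow> Z\<close> of bounded prelinear Hilbert algebras extends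
  along \<open>\<phi>\<close> to a Heyting homomorphism of \<open>H\<^sup>*\<close> into \<open>Z\<^sup>*\<close> (\<open>star_extension\<close>). Secondly, the
  Hilbert subalgebras of a prelinear Heyting algebra that contain \<open>0\<close> are bounded prelinear
  Hilbert algebras (\<open>PHey_imp_PHil0\<close>, \<open>PHil0_hilbert_generated\<close>). Given \<open>f : H \<rightarrow> Z\<close> and
  \<open>g : G \<rightarrow> Z\<close>, the extensions of \<open>f\<close> and \<open>g\<close> induce a Heyting homomorphism from the coproduct of
  \<open>H\<^sup>*\<close> and \<open>G\<^sup>*\<close> into \<open>Z\<^sup>*\<close>. It sends \<open>\<eta>\<close> into \<open>\<phi>(Z)\<close>. This is a Hilbert subalgebra of \<open>Z\<^sup>*\<close>, and so the
  whole Hilbert subalgebra generated by \<open>\<eta>\<close> is sent into \<open>\<phi>(Z)\<close>, a copy of \<open>Z\<close>. Uniqueness of the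
  induced map is clear because \<open>\<eta>\<close> generates.

  Both facts rest on a description of the irreducible filters. In a Hilbert algebra with
  \<open>((a \<rightarrow> b) \<rightarrow> c) \<rightarrow> (((b \<rightarrow> a) \<rightarrow> c) \<rightarrow> c) = 1\<close>, an identity valid in every chain, a proper filter \<open>P\<close>
  is irreducible iff it is total: it contains \<open>a \<rightarrow> b\<close> or \<open>b \<rightarrow> a\<close> for all \<open>a\<close>, \<open>b\<close>
  (\<open>irreducible_iff_total\<close>).

  The filters above a total one form a chain. So the irreducible filters form a forest, whose
  upsets are a prelinear Heyting algebra. Cutting the forest down to the part above one filter
  gives a homomorphism to a chain, and there are enough of these to show that the identity
  axiomatises prelinearity (\<open>prelinear_hilbert_iff\<close>). In a prelinear Heyting algebra the identity
  is a short computation.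

  Totality also passes to preimages under a homomorphism \<open>f\<close>, so that \<open>Q \<mapsto> f\<^sup>-\<^sup>1(Q)\<close> is a monotone
  map between the forests. The filter generated by \<open>Q\<close> and \<open>f(P)\<close> shows that it lifts inclusions
  \<open>f\<^sup>-\<^sup>1(Q) \<subseteq> P\<close> (\<open>filter_lifting\<close>), which is what makes taking preimages of upsets commute with the
  Heyting implication.
\<close>

section \<open>Hilbert algebras and their implicative filters\<close>

context hilbert_algebra
begin

lemma one_imp_eq_oneD: "b \<in> carrier H \<Longrightarrow> \<one> \<Rrightarrow> b = \<one> \<Longrightarrow> b = \<one>"
  using imp_antisym[of b \<one>] imp_K[of b \<one>] one_closed by simp

lemma imp_refl:
  assumes a: "a \<in> carrier H" shows "a \<Rrightarrow> a = \<one>"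
proof -
  have "\<one> \<Rrightarrow> (\<one> \<Rrightarrow> (a \<Rrightarrow> a)) = \<one>"
    using imp_S[of a "a \<Rrightarrow> a" a] a by (simp add: imp_K imp_closed)
  then show ?thesis by (rule one_imp_eq_oneD[rotated, OF one_imp_eq_oneD[rotated]])
      (use a in \<open>simp_all add: imp_closed one_closed\<close>)
qed

lemma imp_one: "a \<in> carrier H \<Longrightarrow> a \<Rrightarrow> \<one> = \<one>"
  using imp_K[of a a] imp_refl by simp

lemma one_imp:
  assumes a: "a \<in> carrier H" shows "\<one> \<Rrightarrow> a = a"
proof (rule imp_antisym)
  show "a \<Rrightarrow> (\<one> \<Rrightarrow> a) = \<one>" using a by (simp add: imp_K one_closed)
  have "\<one> \<Rrightarrow> (\<one> \<Rrightarrow> ((\<one> \<Rrightarrow> a) \<Rrightarrow> a)) = \<one>"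
    using imp_S[of "\<one> \<Rrightarrow> a" \<one> a] a by (simp add: imp_refl imp_one imp_closed one_closed)
  then show "(\<one> \<Rrightarrow> a) \<Rrightarrow> a = \<one>"
    by (rule one_imp_eq_oneD[rotated, OF one_imp_eq_oneD[rotated]])
      (use a in \<open>simp_all add: imp_closed one_closed\<close>)
qed (use a in \<open>simp_all add: imp_closed one_closed\<close>)

lemma filter_mp:
  assumes "implicative_filter H F" "a \<in> F" "a \<Rrightarrow> b \<in> F" "b \<in> carrier H"
  shows "b \<in> F"
  using assms unfolding implicative_filter_def by blast

lemma filter_up:
  assumes "implicative_filter H F" "a \<in> F" "a \<Rrightarrow> b = \<one>" "b \<in> carrier H"
  shows "b \<in> F"
  using assms unfolding implicative_filter_def by (metis subsetD)

lemma filter_weaken: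
  assumes F: "implicative_filter H F" and "a \<in> F" "b \<in> carrier H"
  shows "b \<Rrightarrow> a \<in> F"
proof -
  have "a \<in> carrier H" using assms by (auto simp: implicative_filter_def)
  then show ?thesis using filter_up[OF F \<open>a \<in> F\<close>] assms by (simp add: imp_K imp_closed)
qed

lemma filter_distrib:
  assumes F: "implicative_filter H F" and c: "a \<in> carrier H" "b \<in> carrier H" "c \<in> carrier H"
    and "a \<Rrightarrow> (b \<Rrightarrow> c) \<in> F" "a \<Rrightarrow> b \<in> F"
  shows "a \<Rrightarrow> c \<in> F"
  using filter_mp[OF F \<open>a \<Rrightarrow> b \<in> F\<close>] filter_up[OF F \<open>a \<Rrightarrow> (b \<Rrightarrow> c) \<in> F\<close> imp_S] c
  by (simp add: imp_closed)

lemma filter_trans: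
  assumes F: "implicative_filter H F" and c: "a \<in> carrier H" "b \<in> carrier H" "c \<in> carrier H"
    and "a \<Rrightarrow> b \<in> F" "b \<Rrightarrow> c \<in> F"
  shows "a \<Rrightarrow> c \<in> F"
  using filter_distrib[OF F c] filter_weaken[OF F \<open>b \<Rrightarrow> c \<in> F\<close>] assms by simp

text \<open>By the deduction theorem, this is the filter generated by \<open>F\<close> and \<open>a\<close>.\<close>

definition adjoin :: "'a set \<Rightarrow> 'a \<Rightarrow> 'a set" where
  "adjoin F a = {x \<in> carrier H. a \<Rrightarrow> x \<in> F}"

lemma filter_adjoin:
  assumes F: "implicative_filter H F" and a: "a \<in> carrier H"
  shows "implicative_filter H (adjoin F a)" "F \<subseteq> adjoin F a" "a \<in> adjoin F a"
proof -
  have one: "\<one> \<in> F" and sub: "F \<subseteq> carrier H" using F by (auto simp: implicative_filter_def)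
  show "implicative_filter H (adjoin F a)"
    unfolding implicative_filter_def adjoin_def
    using filter_distrib[OF F a] a one by (auto simp: one_closed imp_one)
  show "F \<subseteq> adjoin F a" using filter_weaken[OF F _ a] sub by (auto simp: adjoin_def)
  show "a \<in> adjoin F a" using a one by (simp add: adjoin_def imp_refl)
qed

text \<open>
  A filter that is maximal among those omitting \<open>a\<close> is irreducible: if it is \<open>F\<^sub>1 \<inter> F\<^sub>2\<close>, then one of
  the \<open>F\<^sub>i\<close> omits \<open>a\<close> as well and is equal to it by maximality.
\<close>

lemma irreducible_separation:
  assumes F: "implicative_filter H F" and a: "a \<in> carrier H" "a \<notin> F"
  obtains P where "P \<in> irr_filters H" "F \<subseteq> P" "a \<notin> P"
proof -
  let ?A = "{Q. implicative_filter H Q \<and> F \<subseteq> Q \<and> a \<notin> Q}"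
  have "\<exists>M\<in>?A. \<forall>X\<in>?A. M \<subseteq> X \<longrightarrow> X = M"
  proof (rule subset_Zorn_nonempty)
    show "?A \<noteq> {}" using F a by auto
    fix K assume K: "K \<noteq> {}" "subset.chain ?A K"
    then have KA: "\<And>Q. Q \<in> K \<Longrightarrow> implicative_filter H Q \<and> F \<subseteq> Q \<and> a \<notin> Q"
      and tot: "\<And>Q R. Q \<in> K \<Longrightarrow> R \<in> K \<Longrightarrow> Q \<subseteq> R \<or> R \<subseteq> Q"
      by (auto simp: subset_chain_def)
    have "implicative_filter H (\<Union>K)"
      unfolding implicative_filter_def
    proof (intro conjI ballI impI)
      show "\<Union>K \<subseteq> carrier H" "\<one> \<in> \<Union>K" using KA K(1) unfolding implicative_filter_def by blast+
      fix x y assume y: "y \<in> carrier H" and xy: "x \<in> \<Union>K \<and> x \<Rrightarrow> y \<in> \<Union>K"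
      then obtain Q R where QR: "Q \<in> K" "R \<in> K" "x \<in> Q" "x \<Rrightarrow> y \<in> R" by blast
      then obtain S where S: "S \<in> K" "x \<in> S" "x \<Rrightarrow> y \<in> S" using tot[of Q R] by blast
      then show "y \<in> \<Union>K" using filter_mp[OF conjunct1[OF KA[OF S(1)]] S(2,3) y] by blast
    qed
    then show "\<Union>K \<in> ?A" using KA K(1) by auto
  qed
  then obtain M where "M \<in> ?A" and M_max: "\<forall>X \<in> ?A. M \<subseteq> X \<longrightarrow> X = M" by (rule bexE)
  then have M: "implicative_filter H M" "F \<subseteq> M" "a \<notin> M" by simp_all
  have max: "X = M" if "implicative_filter H X" "F \<subseteq> X" "a \<notin> X" "M \<subseteq> X" for X
    using that M_max by simp
  have "M = F1 \<or> M = F2"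
    if "implicative_filter H F1" "implicative_filter H F2" "M = F1 \<inter> F2" for F1 F2
  proof (rule ccontr)
    assume *: "\<not> (M = F1 \<or> M = F2)"
    have "M \<subseteq> F1" "M \<subseteq> F2" using that(3) by auto
    then have "a \<in> F1" "a \<in> F2" using max[OF that(1)] max[OF that(2)] M(2) * by auto
    then show False using M(3) that(3) by simp
  qed
  then have "M \<in> irr_filters H"
    using M a by (auto simp: irr_filters_def irreducible_filter_def)
  then show thesis using M that by blast
qed

lemma filter_singleton_one: "implicative_filter H {\<one>}"
  unfolding implicative_filter_def using one_closed one_imp by fastforce

lemma irr_filterD:
  assumes "P \<in> irr_filters H"
  shows "implicative_filter H P" "P \<subseteq> carrier H" "P \<noteq> carrier H" "\<one> \<in> P"
proof -
  show F: "implicative_filter H P" and "P \<noteq> carrier H"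
    using assms unfolding irr_filters_def irreducible_filter_def by blast+
  show "P \<subseteq> carrier H" "\<one> \<in> P" using F unfolding implicative_filter_def by blast+
qed

text \<open>
  If \<open>a \<rightarrow> b \<notin> P\<close>, then \<open>b\<close> lies outside the filter generated by \<open>P\<close> and \<open>a\<close>, and an
  irreducible filter separates the two.
\<close>

lemma imp_mem_irr_filter_iff:
  assumes P: "P \<in> irr_filters H" and c: "a \<in> carrier H" "b \<in> carrier H"
  shows "a \<Rrightarrow> b \<in> P \<longleftrightarrow> (\<forall>Q \<in> irr_filters H. P \<subseteq> Q \<and> a \<in> Q \<longrightarrow> b \<in> Q)"
proof
  assume ab: "a \<Rrightarrow> b \<in> P"
  show "\<forall>Q \<in> irr_filters H. P \<subseteq> Q \<and> a \<in> Q \<longrightarrow> b \<in> Q"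
  proof (intro ballI impI)
    fix Q assume Q: "Q \<in> irr_filters H" "P \<subseteq> Q \<and> a \<in> Q"
    then show "b \<in> Q" using filter_mp[OF irr_filterD(1)[OF Q(1)] _ _ c(2)] ab by blast
  qed
next
  assume *: "\<forall>Q \<in> irr_filters H. P \<subseteq> Q \<and> a \<in> Q \<longrightarrow> b \<in> Q"
  note adj = filter_adjoin[OF irr_filterD(1)[OF P] c(1)]
  have "b \<in> adjoin P a"
  proof (rule ccontr)
    assume "b \<notin> adjoin P a"
    then obtain Q where "Q \<in> irr_filters H" "adjoin P a \<subseteq> Q" "b \<notin> Q"
      using irreducible_separation[OF adj(1) c(2)] by blast
    then show False using * adj by blast
  qed
  then show "a \<Rrightarrow> b \<in> P" by (simp add: adjoin_def)
qed

lemma phi_inj: "inj_on (phi H) (carrier H)"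
proof (rule inj_onI)
  have one: "a \<Rrightarrow> b = \<one>" if c: "a \<in> carrier H" "b \<in> carrier H" and eq: "phi H a = phi H b" for a b
  proof (rule ccontr)
    assume "a \<Rrightarrow> b \<noteq> \<one>"
    then obtain P where P: "P \<in> irr_filters H" "a \<Rrightarrow> b \<notin> P"
      using irreducible_separation[OF filter_singleton_one imp_closed[OF c]] by blast
    then show False using imp_mem_irr_filter_iff[OF P(1) c] eq by (auto simp: phi_def)
  qed
  fix a b assume "a \<in> carrier H" "b \<in> carrier H" "phi H a = phi H b"
  then show "a = b" using one[of a b] one[of b a] imp_antisym by simp
qed

end

section \<open>Prelinearity and total filters\<close>

definition prelinear_identity :: "('a, 'm) hilbert_scheme \<Rightarrow> bool" where
  "prelinear_identity H \<longleftrightarrow> (\<forall>a \<in> carrier H. \<forall>b \<in> carrier H. \<forall>c \<in> carrier H.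
    imp H (imp H (imp H a b) c) (imp H (imp H (imp H b a) c) c) = one H)"

definition total_filter :: "('a, 'm) hilbert_scheme \<Rightarrow> 'a set \<Rightarrow> bool" where
  "total_filter H P \<longleftrightarrow> implicative_filter H P \<and>
    (\<forall>a \<in> carrier H. \<forall>b \<in> carrier H. imp H a b \<in> P \<or> imp H b a \<in> P)"

context hilbert_algebra
begin

lemma total_filter_comparable:
  assumes P: "total_filter H P" and Q: "implicative_filter H Q" "P \<subseteq> Q"
    and R: "implicative_filter H R" "P \<subseteq> R"
  shows "Q \<subseteq> R \<or> R \<subseteq> Q"
proof (rule ccontr)
  assume "\<not> (Q \<subseteq> R \<or> R \<subseteq> Q)"
  then obtain a b where ab: "a \<in> Q" "a \<notin> R" "b \<in> R" "b \<notin> Q" by blast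
  then have c: "a \<in> carrier H" "b \<in> carrier H" using Q R by (auto simp: implicative_filter_def)
  then have "a \<Rrightarrow> b \<in> P \<or> b \<Rrightarrow> a \<in> P" using P by (simp add: total_filter_def)
  then show False using filter_mp[OF Q(1) ab(1) _ c(2)] filter_mp[OF R(1) ab(3) _ c(1)] ab Q R by blast
qed

text \<open>
  Prelinearity says that \<open>P\<close> is the intersection of the filters generated by \<open>P\<close> together
  with \<open>a \<rightarrow> b\<close> and with \<open>b \<rightarrow> a\<close>; if \<open>P\<close> is irreducible, one of the two is \<open>P\<close>. Conversely, the
  filters above a total one are linearly ordered, and so the intersection of two of them is one
  of them.
\<close>

lemma irreducible_iff_total:
  assumes pre: "prelinear_identity H"
  shows "P \<in> irr_filters H \<longleftrightarrow> total_filter H P \<and> P \<noteq> carrier H"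
proof
  assume P: "P \<in> irr_filters H"
  note F = irr_filterD(1)[OF P]
  have "a \<Rrightarrow> b \<in> P \<or> b \<Rrightarrow> a \<in> P" if c: "a \<in> carrier H" "b \<in> carrier H" for a b
  proof -
    note cc = imp_closed[OF c] imp_closed[OF c(2,1)]
    note adj = filter_adjoin[OF F cc(1)] filter_adjoin[OF F cc(2)]
    have "x \<in> P" if "x \<in> adjoin P (a \<Rrightarrow> b)" "x \<in> adjoin P (b \<Rrightarrow> a)" for x
    proof -
      have x: "x \<in> carrier H" "(a \<Rrightarrow> b) \<Rrightarrow> x \<in> P" "(b \<Rrightarrow> a) \<Rrightarrow> x \<in> P"
        using that by (auto simp: adjoin_def)
      have "((a \<Rrightarrow> b) \<Rrightarrow> x) \<Rrightarrow> (((b \<Rrightarrow> a) \<Rrightarrow> x) \<Rrightarrow> x) = \<one>"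
        using pre c x(1) by (simp add: prelinear_identity_def)
      then have "((b \<Rrightarrow> a) \<Rrightarrow> x) \<Rrightarrow> x \<in> P"
        using filter_up[OF F x(2)] x(1) cc by (simp add: imp_closed)
      then show "x \<in> P" by (rule filter_mp[OF F x(3) _ x(1)])
    qed
    then have "P = adjoin P (a \<Rrightarrow> b) \<inter> adjoin P (b \<Rrightarrow> a)" using adj by blast
    then have "P = adjoin P (a \<Rrightarrow> b) \<or> P = adjoin P (b \<Rrightarrow> a)"
      using P adj(1,4) unfolding irr_filters_def irreducible_filter_def by blast
    then show ?thesis using adj by blast
  qed
  then show "total_filter H P \<and> P \<noteq> carrier H"
    using F irr_filterD(3)[OF P] by (simp add: total_filter_def)
next
  assume P: "total_filter H P \<and> P \<noteq> carrier H"
  then have "P = F1 \<or> P = F2"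
    if "implicative_filter H F1" "implicative_filter H F2" "P = F1 \<inter> F2" for F1 F2
    using total_filter_comparable[of P F1 F2] that by blast
  then show "P \<in> irr_filters H"
    using P by (auto simp: irr_filters_def irreducible_filter_def total_filter_def)
qed

end

section \<open>Heyting algebras and their Hilbert reducts\<close>

context heyting_algebra
begin

lemma imp_eq_one_iff:
  assumes "a \<in> carrier A" "b \<in> carrier A"
  shows "a \<Rrightarrow> b = \<one> \<longleftrightarrow> a \<sqinter> b = a"
proof -
  have "\<one> \<sqinter> x = x" if "x \<in> carrier A" for x
    using that by (metis meet_comm meet_one one_closed)
  then show ?thesis using residuation[OF one_closed assms] assms by (simp add: imp_closed)
qed

lemma le_trans:
  assumes "a \<in> carrier A" "b \<in> carrier A" "c \<in> carrier A" "a \<sqinter> b = a" "b \<sqinter> c = b"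
  shows "a \<sqinter> c = a"
  using assms by (metis meet_assoc)

lemma meet_idem: "a \<in> carrier A \<Longrightarrow> a \<sqinter> a = a"
  by (metis join_absorb meet_absorb meet_closed)

lemma meet_le:
  assumes "a \<in> carrier A" "b \<in> carrier A"
  shows "(a \<sqinter> b) \<sqinter> a = a \<sqinter> b" "(a \<sqinter> b) \<sqinter> b = a \<sqinter> b"
  using assms by (metis meet_assoc meet_comm meet_idem)+

lemma join_leI:
  assumes "a \<in> carrier A" "b \<in> carrier A" "c \<in> carrier A" "a \<sqinter> c = a" "b \<sqinter> c = b"
  shows "(a \<squnion> b) \<sqinter> c = a \<squnion> b"
proof -
  have "a \<squnion> c = c" "b \<squnion> c = c"
    using assms by (metis join_absorb join_comm meet_comm)+
  then have "(a \<squnion> b) \<squnion> c = c" using assms by (metis join_assoc)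
  then show ?thesis using assms by (metis join_closed meet_absorb)
qed

lemma hilbert_algebra_reduct: "hilbert_algebra A"
proof
  fix a b assume c: "a \<in> carrier A" "b \<in> carrier A"
  show "a \<Rrightarrow> (b \<Rrightarrow> a) = \<one>"
    using c by (simp add: imp_eq_one_iff imp_closed meet_le flip: residuation)
  show "a = b" if "a \<Rrightarrow> b = \<one>" "b \<Rrightarrow> a = \<one>"
    using that c by (simp add: imp_eq_one_iff) (metis meet_comm)
next
  fix a b c assume c: "a \<in> carrier A" "b \<in> carrier A" "c \<in> carrier A"
  let ?x = "a \<Rrightarrow> (b \<Rrightarrow> c)" and ?y = "a \<Rrightarrow> b"
  have cl: "?x \<in> carrier A" "?y \<in> carrier A" using c by (simp_all add: imp_closed)
  let ?z = "(?x \<sqinter> ?y) \<sqinter> a"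
  have z: "?z \<in> carrier A" using c cl by (simp add: meet_closed)
  have mp: "u \<sqinter> q = u" if "u \<in> carrier A" "p \<in> carrier A" "q \<in> carrier A" "u \<sqinter> p = u" "u \<sqinter> (p \<Rrightarrow> q) = u"
    for u p q using that residuation[of u p q] by simp
  have za: "?z \<sqinter> a = ?z" using c cl by (simp add: meet_closed meet_le)
  have zx: "?z \<sqinter> ?x = ?z"
    by (rule le_trans[of _ "?x \<sqinter> ?y"]) (use c cl in \<open>simp_all add: meet_closed meet_le\<close>)
  have zy: "?z \<sqinter> ?y = ?z"
    by (rule le_trans[of _ "?x \<sqinter> ?y"]) (use c cl in \<open>simp_all add: meet_closed meet_le\<close>)
  have zb: "?z \<sqinter> b = ?z" by (rule mp[OF z c(1,2) za zy])
  have "?z \<sqinter> (b \<Rrightarrow> c) = ?z" by (rule mp[OF z c(1) imp_closed[OF c(2,3)] za zx])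
  then have "?z \<sqinter> c = ?z" by (rule mp[OF z c(2,3) zb])
  then show "?x \<Rrightarrow> (?y \<Rrightarrow> (a \<Rrightarrow> c)) = \<one>"
    using c cl by (simp add: imp_eq_one_iff imp_closed meet_closed flip: residuation)
qed (simp_all add: one_closed imp_closed)

lemma zero_le: "a \<in> carrier A \<Longrightarrow> nat_le A \<zero> a"
  unfolding nat_le_def using imp_eq_one_iff[of \<zero> a] zero_closed
  by (metis join_comm join_zero meet_absorb)

end

text \<open>
  If \<open>u = ((a \<rightarrow> b) \<rightarrow> c) \<sqinter> ((b \<rightarrow> a) \<rightarrow> c)\<close>, then both \<open>a \<rightarrow> b\<close> and \<open>b \<rightarrow> a\<close> lie below \<open>u \<rightarrow> c\<close>, hence so does
  their join, which is \<open>1\<close>.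
\<close>

lemma (in PHey) prelinear_identity_reduct: "prelinear_identity A"
  unfolding prelinear_identity_def
proof (intro ballI)
  fix a b c assume c: "a \<in> carrier A" "b \<in> carrier A" "c \<in> carrier A"
  let ?p = "a \<Rrightarrow> b" and ?q = "b \<Rrightarrow> a"
  let ?u = "(?p \<Rrightarrow> c) \<sqinter> (?q \<Rrightarrow> c)"
  have cl: "?p \<in> carrier A" "?q \<in> carrier A" "?p \<Rrightarrow> c \<in> carrier A" "?q \<Rrightarrow> c \<in> carrier A"
    "?u \<in> carrier A" "?u \<Rrightarrow> c \<in> carrier A"
    using c by (simp_all add: imp_closed meet_closed)
  have *: "r \<sqinter> (?u \<Rrightarrow> c) = r" if r: "r \<in> carrier A" and "?u \<sqinter> (r \<Rrightarrow> c) = ?u" for r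
  proof -
    have "(?u \<sqinter> r) \<sqinter> c = ?u \<sqinter> r" using that residuation[of ?u r c] cl c by simp
    then show ?thesis using residuation[of r ?u c] cl c r by (simp add: meet_comm)
  qed
  have "(?p \<squnion> ?q) \<sqinter> (?u \<Rrightarrow> c) = ?p \<squnion> ?q"
    by (intro join_leI *) (use cl in \<open>simp_all add: meet_le\<close>)
  then have "\<one> \<sqinter> (?u \<Rrightarrow> c) = \<one>" using c by (simp add: prelinear)
  then have "?u \<Rrightarrow> c = \<one>" using cl by (metis meet_comm meet_one one_closed)
  then show "(?p \<Rrightarrow> c) \<Rrightarrow> ((?q \<Rrightarrow> c) \<Rrightarrow> c) = \<one>"
    using cl c by (simp add: imp_eq_one_iff imp_closed residuation)
qed

section \<open>Upset algebras\<close>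

lemma mem_upset_imp:
  "P \<in> imp (upset_algebra X) U V \<longleftrightarrow> P \<in> X \<and> (\<forall>Q \<in> X. P \<subseteq> Q \<and> Q \<in> U \<longrightarrow> Q \<in> V)"
  by (auto simp: upset_algebra_def downset_of_def)

lemma upset_algebra_simps:
  "carrier (upset_algebra X) = upsets X" "one (upset_algebra X) = X" "zero (upset_algebra X) = {}"
  "meet (upset_algebra X) U V = U \<inter> V" "join (upset_algebra X) U V = U \<union> V"
  by (simp_all add: upset_algebra_def)

lemma upsetsI:
  assumes "U \<subseteq> X" "\<And>P Q. P \<in> U \<Longrightarrow> Q \<in> X \<Longrightarrow> P \<subseteq> Q \<Longrightarrow> Q \<in> U"
  shows "U \<in> upsets X"
  unfolding upsets_def by (intro CollectI conjI ballI impI) (rule assms; assumption)+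

lemma upsets_subset: "U \<in> upsets X \<Longrightarrow> U \<subseteq> X"
  unfolding upsets_def by (elim CollectE conjE)

lemma upsets_up:
  assumes "U \<in> upsets X" "P \<in> U" "Q \<in> X" "P \<subseteq> Q"
  shows "Q \<in> U"
proof -
  have *: "\<forall>P \<in> U. \<forall>Q \<in> X. P \<subseteq> Q \<longrightarrow> Q \<in> U" using assms(1) unfolding upsets_def by (elim CollectE conjE)
  show ?thesis by (rule bspec[OF bspec[OF * assms(2)] assms(3), THEN mp, OF assms(4)])
qed

lemma upsets_Int: "U \<in> upsets X \<Longrightarrow> V \<in> upsets X \<Longrightarrow> U \<inter> V \<in> upsets X"
  by (rule upsetsI) (auto dest: upsets_subset intro: upsets_up)

lemma upsets_Un: "U \<in> upsets X \<Longrightarrow> V \<in> upsets X \<Longrightarrow> U \<union> V \<in> upsets X"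
  by (rule upsetsI) (auto dest: upsets_subset intro: upsets_up)

lemma upset_imp_closed: "imp (upset_algebra X) U V \<in> upsets X"
  by (rule upsetsI) (auto simp: mem_upset_imp)

lemma heyting_algebra_upsets: "heyting_algebra (upset_algebra X)"
proof
  fix U V W :: "'a set set"
  assume "U \<in> carrier (upset_algebra X)" "V \<in> carrier (upset_algebra X)" "W \<in> carrier (upset_algebra X)"
  then have U: "U \<in> upsets X" by (simp add: upset_algebra_simps)
  have "U \<inter> V \<subseteq> W \<longleftrightarrow> U \<subseteq> imp (upset_algebra X) V W"
  proof (intro iffI subsetI)
    fix P assume "U \<inter> V \<subseteq> W" "P \<in> U"
    then show "P \<in> imp (upset_algebra X) V W" unfolding mem_upset_imp using upsets_subset[OF U] upsets_up[OF U] by blast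
  next
    fix P assume "U \<subseteq> imp (upset_algebra X) V W" "P \<in> U \<inter> V"
    then have "P \<in> imp (upset_algebra X) V W" "P \<in> V" by blast+
    then show "P \<in> W" by (simp add: mem_upset_imp)
  qed
  then show "meet (upset_algebra X) (meet (upset_algebra X) U V) W = meet (upset_algebra X) U V \<longleftrightarrow>
      meet (upset_algebra X) U (imp (upset_algebra X) V W) = U"
    by (simp add: upset_algebra_simps Int_absorb2 inf.absorb_iff1)
next
  fix U V assume "U \<in> carrier (upset_algebra X)" "V \<in> carrier (upset_algebra X)"
  then show "meet (upset_algebra X) U V \<in> carrier (upset_algebra X)"
    "join (upset_algebra X) U V \<in> carrier (upset_algebra X)"
    unfolding upset_algebra_simps by (rule upsets_Int, rule upsets_Un)
next
  show "one (upset_algebra X) \<in> carrier (upset_algebra X)"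
    "zero (upset_algebra X) \<in> carrier (upset_algebra X)"
    by (auto simp: upset_algebra_simps intro: upsetsI)
  fix U assume "U \<in> carrier (upset_algebra X)"
  then have "U \<subseteq> X" by (simp add: upset_algebra_simps upsets_subset)
  then show "meet (upset_algebra X) U (one (upset_algebra X)) = U"
    by (simp add: upset_algebra_simps Int_absorb2)
qed (simp_all add: upset_algebra_simps upset_imp_closed Int_ac Un_ac)

text \<open>
  A failure of prelinearity at \<open>P\<close> would give \<open>Q\<close>, \<open>R\<close> above \<open>P\<close> with \<open>Q \<in> U - V\<close> and \<open>R \<in> V - U\<close>. Such
  \<open>Q\<close> and \<open>R\<close> are incomparable.
\<close>

lemma PHey_upsets_forest:
  assumes forest: "\<And>P Q R. P \<in> X \<Longrightarrow> Q \<in> X \<Longrightarrow> R \<in> X \<Longrightarrow> P \<subseteq> Q \<Longrightarrow> P \<subseteq> R \<Longrightarrow> Q \<subseteq> R \<or> R \<subseteq> Q"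
  shows "PHey (upset_algebra X)"
proof (rule PHey.intro[OF heyting_algebra_upsets], unfold_locales)
  fix U V assume "U \<in> carrier (upset_algebra X)" "V \<in> carrier (upset_algebra X)"
  then have UV: "U \<in> upsets X" "V \<in> upsets X" by (simp_all add: upset_algebra_simps)
  have "P \<in> imp (upset_algebra X) U V \<or> P \<in> imp (upset_algebra X) V U" if P: "P \<in> X" for P
  proof (rule ccontr)
    assume "\<not> ?thesis"
    then obtain Q R where "Q \<in> X" "P \<subseteq> Q" "Q \<in> U" "Q \<notin> V" "R \<in> X" "P \<subseteq> R" "R \<in> V" "R \<notin> U"
      using P by (auto simp: mem_upset_imp)
    then show False using forest[OF P] upsets_up[OF UV(1)] upsets_up[OF UV(2)] by metis
  qed
  moreover have "imp (upset_algebra X) U V \<subseteq> X" "imp (upset_algebra X) V U \<subseteq> X"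
    by (auto simp: mem_upset_imp)
  ultimately show "join (upset_algebra X) (imp (upset_algebra X) U V) (imp (upset_algebra X) V U) =
      one (upset_algebra X)"
    unfolding upset_algebra_simps by blast
qed

lemma hilbert_chain_upsets:
  assumes chain: "\<And>P Q. P \<in> X \<Longrightarrow> Q \<in> X \<Longrightarrow> P \<subseteq> Q \<or> Q \<subseteq> P"
  shows "hilbert_chain (upset_algebra X)"
proof -
  interpret heyting_algebra "upset_algebra X" by (rule heyting_algebra_upsets)
  interpret hilbert_algebra "upset_algebra X" by (rule hilbert_algebra_reduct)
  show ?thesis
  proof
    fix U V assume c: "U \<in> carrier (upset_algebra X)" "V \<in> carrier (upset_algebra X)"
    have "U \<subseteq> V \<or> V \<subseteq> U"
    proof (rule ccontr)
      assume "\<not> (U \<subseteq> V \<or> V \<subseteq> U)"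
      then obtain P Q where PQ: "P \<in> U" "P \<notin> V" "Q \<in> V" "Q \<notin> U" by blast
      have UV: "U \<in> upsets X" "V \<in> upsets X" using c by (simp_all add: upset_algebra_simps)
      then have "P \<in> X" "Q \<in> X" using PQ upsets_subset by blast+
      then show False using chain[of P Q] PQ upsets_up[OF UV(1)] upsets_up[OF UV(2)] by metis
    qed
    then show "nat_le (upset_algebra X) U V \<or> nat_le (upset_algebra X) V U"
      using c by (auto simp: nat_le_def imp_eq_one_iff) (auto simp: upset_algebra_simps)
  qed
qed

section \<open>The prelinear identity axiomatises prelinearity\<close>

text \<open>
  For an irreducible filter \<open>P\<close>, the map \<open>a \<mapsto> {Q \<supseteq> P. a \<in> Q}\<close> is a homomorphism into the upsets of
  the chain of irreducible filters above \<open>P\<close>. These homomorphisms jointly separate points, so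
  every identity of chains carries over.
\<close>

lemma prelinear_hilbertI:
  fixes H :: "('a, 'm) hilbert_scheme"
  assumes "hilbert_algebra H" and pre: "prelinear_identity H"
  shows "prelinear_hilbert H"
  unfolding prelinear_hilbert_def
proof (intro conjI allI impI)
  interpret hilbert_algebra H by fact
  show "hilbert_algebra H" by fact
  fix s t assume st: "chain_identity s t"
  show "hilbert_identity H s t" unfolding hilbert_identity_def
  proof (intro allI impI)
    fix v :: "nat \<Rightarrow> 'a" assume v: "range v \<subseteq> carrier H"
    have cl: "hilbert_eval H v r \<in> carrier H" for r
      by (rule hilbert_eval_closed) (use v one_closed imp_closed in auto)
    have "hilbert_eval H v s \<in> P \<longleftrightarrow> hilbert_eval H v t \<in> P" if P: "P \<in> irr_filters H" for P
    proof -
      define Y where "Y = {Q \<in> irr_filters H. P \<subseteq> Q}"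
      define psi where "psi a = {Q \<in> Y. a \<in> Q}" for a
      have "total_filter H P" using irreducible_iff_total[OF pre] P by blast
      then have "hilbert_chain (upset_algebra Y)"
        by (intro hilbert_chain_upsets total_filter_comparable) (auto simp: Y_def irr_filterD(1))
      then have id: "hilbert_identity (upset_algebra Y) s t"
        using st by (rule hilbert_identity_all_chains)
      have psi_imp: "psi (imp H a b) = imp (upset_algebra Y) (psi a) (psi b)"
        if "a \<in> carrier H" "b \<in> carrier H" for a b
      proof (rule Set.set_eqI)
        fix Q show "Q \<in> psi (imp H a b) \<longleftrightarrow> Q \<in> imp (upset_algebra Y) (psi a) (psi b)"
          using imp_mem_irr_filter_iff[OF _ that, of Q] unfolding mem_upset_imp psi_def Y_def by auto
      qed
      have ev: "hilbert_eval (upset_algebra Y) (psi \<circ> v) r = psi (hilbert_eval H v r)" for r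
      proof (induction r)
        case HOne
        then show ?case by (auto simp: upset_algebra_simps psi_def Y_def irr_filterD)
      qed (simp_all add: psi_imp cl)
      have "range (psi \<circ> v) \<subseteq> carrier (upset_algebra Y)"
        by (auto simp: upset_algebra_simps psi_def intro: upsetsI)
      then have "psi (hilbert_eval H v s) = psi (hilbert_eval H v t)"
        using id ev unfolding hilbert_identity_def by metis
      then show ?thesis using P by (auto simp: psi_def Y_def)
    qed
    then have "phi H (hilbert_eval H v s) = phi H (hilbert_eval H v t)" by (auto simp: phi_def)
    then show "hilbert_eval H v s = hilbert_eval H v t" by (rule inj_onD[OF phi_inj]) (rule cl)+
  qed
qed

text \<open>
  In a chain \<open>a \<rightarrow> b = 1\<close> or \<open>b \<rightarrow> a = 1\<close>. The identity then reads \<open>c \<rightarrow> (y \<rightarrow> c) = 1\<close> or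
  \<open>x \<rightarrow> (c \<rightarrow> c) = 1\<close>.
\<close>

lemma chain_prelinear_identity:
  assumes "hilbert_chain K" shows "prelinear_identity K"
proof -
  interpret hilbert_chain K by fact
  show ?thesis unfolding prelinear_identity_def
  proof (intro ballI)
    fix a b c assume c: "a \<in> carrier K" "b \<in> carrier K" "c \<in> carrier K"
    then consider "imp K a b = one K" | "imp K b a = one K" using total nat_le_def by metis
    then show "imp K (imp K (imp K a b) c) (imp K (imp K (imp K b a) c) c) = one K"
    proof cases
      case 1
      then show ?thesis using c by (simp add: one_imp imp_K imp_closed)
    next
      case 2
      then show ?thesis using c by (simp add: one_imp imp_K imp_refl imp_one imp_closed)
    qed
  qed
qed

lemma prelinear_hilbert_iff:
  fixes H :: "('a, 'm) hilbert_scheme"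
  shows "prelinear_hilbert H \<longleftrightarrow> hilbert_algebra H \<and> prelinear_identity H"
proof
  assume H: "prelinear_hilbert H"
  let ?s = "HImp (HImp (HImp (HVar 0) (HVar 1)) (HVar 2))
    (HImp (HImp (HImp (HVar 1) (HVar 0)) (HVar 2)) (HVar (2 :: nat)))"
  have "chain_identity ?s HOne"
    unfolding chain_identity_def hilbert_identity_def
  proof (intro allI impI)
    fix K :: "nat hilbert" and v :: "nat \<Rightarrow> nat"
    assume "hilbert_chain K" "range v \<subseteq> carrier K"
    then show "hilbert_eval K v ?s = hilbert_eval K v HOne"
      using chain_prelinear_identity[of K] by (simp add: prelinear_identity_def range_subsetD)
  qed
  then have id: "hilbert_identity H ?s HOne" using H by (simp add: prelinear_hilbert_def)
  have "imp H (imp H (imp H a b) c) (imp H (imp H (imp H b a) c) c) = one H"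
    if "a \<in> carrier H" "b \<in> carrier H" "c \<in> carrier H" for a b c
    using id[unfolded hilbert_identity_def, rule_format, of "\<lambda>n. if n = 0 then a else if n = 1 then b else c"] that
    by auto
  then show "hilbert_algebra H \<and> prelinear_identity H"
    using H by (simp add: prelinear_hilbert_def prelinear_identity_def)
qed (simp add: prelinear_hilbertI)

lemma PHil0D:
  assumes "PHil0 H"
  shows "hilbert_algebra H" "prelinear_identity H"
  using assms by (auto simp: PHil0_def prelinear_hilbert_iff)

lemma PHey_imp_PHil0:
  fixes A :: "('a, 'm) heyting_scheme"
  assumes "PHey A" shows "PHil0 A"
proof -
  interpret PHey A by fact
  show ?thesis
    unfolding PHil0_def prelinear_hilbert_iff
    using hilbert_algebra_reduct prelinear_identity_reduct zero_closed zero_le by blast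
qed

lemma PHey_hom_imp_PHil0_hom: "f \<in> PHey_hom A B \<Longrightarrow> f \<in> PHil0_hom A B"
  by (auto simp: PHey_hom_def PHil0_hom_def)

lemma PHil0_hilbert_generated:
  fixes Z :: "('a, 'm) hilbert0_scheme"
  assumes Z: "PHil0 Z" and S: "S \<subseteq> carrier Z" and zero: "zero Z \<in> hilbert_span Z S"
  shows "PHil0 (hilbert_generated Z S)"
proof -
  interpret hilbert_algebra Z using PHil0D(1)[OF Z] .
  have sub: "\<And>x. x \<in> hilbert_span Z S \<Longrightarrow> x \<in> carrier Z" using hilbert_span_sub[OF Z S] by blast
  have "hilbert_algebra (hilbert_generated Z S)"
    by unfold_locales
      (auto simp: hilbert_generated_def sub imp_K imp_S intro: hilbert_span.intros imp_antisym)
  moreover have "prelinear_identity (hilbert_generated Z S)"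
    using PHil0D(2)[OF Z] sub by (auto simp: prelinear_identity_def hilbert_generated_def)
  ultimately show ?thesis
    using Z zero sub by (auto simp: PHil0_def prelinear_hilbert_iff hilbert_generated_def nat_le_def)
qed

lemma hilbert_span_generated: "hilbert_span (hilbert_generated Z S) S = hilbert_span Z S"
proof
  show "hilbert_span (hilbert_generated Z S) S \<subseteq> hilbert_span Z S"
  proof
    fix x assume "x \<in> hilbert_span (hilbert_generated Z S) S"
    then show "x \<in> hilbert_span Z S"
      by induction (auto simp: hilbert_generated_def intro: hilbert_span.intros)
  qed
  show "hilbert_span Z S \<subseteq> hilbert_span (hilbert_generated Z S) S"
  proof
    fix x assume "x \<in> hilbert_span Z S"
    then show "x \<in> hilbert_span (hilbert_generated Z S) S"
    proof induction
      case one
      show ?case using hilbert_span.one[of "hilbert_generated Z S" S] by (simp add: hilbert_generated_def)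
    next
      case (imp x y)
      then show ?case
        using hilbert_span.imp[of x "hilbert_generated Z S" S y] by (simp add: hilbert_generated_def)
    qed (rule hilbert_span.base)
  qed
qed

section \<open>The algebra of upsets generated by a bounded prelinear Hilbert algebra\<close>

lemma star_simps:
  "carrier (star H) = heyting_span (upset_algebra (irr_filters H)) (phi H ` carrier H)"
  "one (star H) = irr_filters H" "zero (star H) = {}"
  "imp (star H) = imp (upset_algebra (irr_filters H))"
  "meet (star H) = (\<inter>)" "join (star H) = (\<union>)"
  by (simp_all add: star_def heyting_generated_def upset_algebra_def)

lemma phi_upset: "phi H a \<in> upsets (irr_filters H)"
  by (rule upsetsI) (auto simp: phi_def)

lemma PHey_upsets_irr_filters:
  assumes "PHil0 H" shows "PHey (upset_algebra (irr_filters H))"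
proof -
  interpret hilbert_algebra H using PHil0D(1)[OF assms] .
  show ?thesis
  proof (rule PHey_upsets_forest)
    fix P Q R assume *: "P \<in> irr_filters H" "Q \<in> irr_filters H" "R \<in> irr_filters H" "P \<subseteq> Q" "P \<subseteq> R"
    then have "total_filter H P" using irreducible_iff_total[OF PHil0D(2)[OF assms]] by simp
    then show "Q \<subseteq> R \<or> R \<subseteq> Q" by (rule total_filter_comparable) (use * irr_filterD(1) in auto)
  qed
qed

lemma star_subset_upsets:
  assumes "PHil0 H" shows "carrier (star H) \<subseteq> upsets (irr_filters H)"
proof -
  have "phi H ` carrier H \<subseteq> carrier (upset_algebra (irr_filters H))"
    unfolding upset_algebra_simps by (rule image_subsetI) (rule phi_upset)
  from heyting_span_sub[OF PHey_upsets_irr_filters[OF assms] this]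
  show ?thesis by (simp add: star_simps upset_algebra_simps)
qed

lemma PHey_star:
  assumes H: "PHil0 H" shows "PHey (star H)"
proof (rule PHey_embedded[OF PHey_upsets_irr_filters[OF H]])
  show "heyting_closed (star H) (carrier (star H))"
    using heyting_closed_span[of "upset_algebra (irr_filters H)" "phi H ` carrier H"]
    by (simp add: heyting_closed_def star_simps upset_algebra_simps)
  show "id \<in> PHey_hom (star H) (upset_algebra (irr_filters H))"
    using star_subset_upsets[OF H] by (auto simp: PHey_hom_def star_simps upset_algebra_simps)
qed simp

lemma zero_notin_irr_filter:
  assumes H: "PHil0 H" and P: "P \<in> irr_filters H" shows "zero H \<notin> P"
proof
  interpret hilbert_algebra H using PHil0D(1)[OF H] .
  assume "zero H \<in> P"
  then have "carrier H \<subseteq> P"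
    using H filter_up[OF irr_filterD(1)[OF P]] by (auto simp: PHil0_def nat_le_def)
  then show False using irr_filterD(2,3)[OF P] by blast
qed

lemma phi_hom:
  assumes H: "PHil0 H" shows "phi H \<in> PHil0_hom H (star H)"
proof -
  interpret hilbert_algebra H using PHil0D(1)[OF H] .
  have "phi H (imp H a b) = imp (star H) (phi H a) (phi H b)"
    if "a \<in> carrier H" "b \<in> carrier H" for a b
  proof (rule Set.set_eqI)
    fix P show "P \<in> phi H (imp H a b) \<longleftrightarrow> P \<in> imp (star H) (phi H a) (phi H b)"
      using imp_mem_irr_filter_iff[OF _ that, of P]
      unfolding star_simps mem_upset_imp by (auto simp: phi_def)
  qed
  moreover have "phi H (one H) = one (star H)" "phi H (zero H) = zero (star H)"
    using irr_filterD(4) zero_notin_irr_filter[OF H] by (auto simp: phi_def star_simps)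
  ultimately show ?thesis
    by (auto simp: PHil0_hom_def star_simps intro: heyting_span.base)
qed

section \<open>Functoriality\<close>

definition filter_preimage ::
  "('a, 'm) hilbert_scheme \<Rightarrow> ('a \<Rightarrow> 'b) \<Rightarrow> 'b set \<Rightarrow> 'a set" where
  "filter_preimage H f Q = {a \<in> carrier H. f a \<in> Q}"

text \<open>
  Totality of \<open>Q\<close> pulls back along any homomorphism; properness does because \<open>f 0 = 0 \<notin> Q\<close>.
\<close>

lemma filter_preimage_irreducible:
  assumes H: "PHil0 H" and Z: "PHil0 Z" and f: "f \<in> PHil0_hom H Z" and Q: "Q \<in> irr_filters Z"
  shows "filter_preimage H f Q \<in> irr_filters H"
proof -
  interpret H: hilbert_algebra H using PHil0D(1)[OF H] .
  interpret Z: hilbert_algebra Z using PHil0D(1)[OF Z] .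
  have Q': "total_filter Z Q" using Z.irreducible_iff_total[OF PHil0D(2)[OF Z]] Q by blast
  have fc: "\<And>a. a \<in> carrier H \<Longrightarrow> f a \<in> carrier Z" using f by (auto simp: PHil0_hom_def)
  have "implicative_filter H (filter_preimage H f Q)"
    unfolding implicative_filter_def
  proof (intro conjI ballI impI)
    show "one H \<in> filter_preimage H f Q"
      using f Z.irr_filterD(4)[OF Q] H.one_closed by (simp add: filter_preimage_def PHil0_hom_def)
    fix a b assume "a \<in> carrier H" "b \<in> carrier H"
      "a \<in> filter_preimage H f Q \<and> imp H a b \<in> filter_preimage H f Q"
    then show "b \<in> filter_preimage H f Q"
      using f Z.filter_mp[OF Z.irr_filterD(1)[OF Q], of "f a" "f b"] fc
      by (auto simp: filter_preimage_def PHil0_hom_def)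
  qed (auto simp: filter_preimage_def)
  moreover have "\<forall>a \<in> carrier H. \<forall>b \<in> carrier H.
      imp H a b \<in> filter_preimage H f Q \<or> imp H b a \<in> filter_preimage H f Q"
    using Q' fc f by (auto simp: total_filter_def filter_preimage_def PHil0_hom_def H.imp_closed)
  moreover have "zero H \<notin> filter_preimage H f Q"
    using zero_notin_irr_filter[OF Z Q] f by (simp add: filter_preimage_def PHil0_hom_def)
  then have "filter_preimage H f Q \<noteq> carrier H" using PHil0_closed(2)[OF H] by blast
  ultimately show ?thesis
    using H.irreducible_iff_total[OF PHil0D(2)[OF H]] by (simp add: total_filter_def)
qed

text \<open>
  \<open>R\<close> is the filter generated by \<open>Q\<close> and \<open>f(P)\<close>, which is total because it contains \<open>Q\<close>. If \<open>f a \<in> R\<close>,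
  then \<open>f (p \<rightarrow> a) \<in> Q\<close> for some \<open>p \<in> P\<close>, so that \<open>p \<rightarrow> a \<in> P\<close> and \<open>a \<in> P\<close>. Without meets, an
  element of \<open>R\<close> is a priori witnessed by finitely many elements of \<open>P\<close>; but any two of these are
  comparable modulo \<open>f\<^sup>-\<^sup>1(Q)\<close>, so a single one suffices.
\<close>

lemma filter_lifting:
  assumes H: "PHil0 H" and Z: "PHil0 Z" and f: "f \<in> PHil0_hom H Z" and Q: "Q \<in> irr_filters Z"
    and P: "P \<in> irr_filters H" and sub: "filter_preimage H f Q \<subseteq> P"
  obtains R where "R \<in> irr_filters Z" "Q \<subseteq> R" "filter_preimage H f R = P"
proof -
  interpret H: hilbert_algebra H using PHil0D(1)[OF H] .
  interpret Z: hilbert_algebra Z using PHil0D(1)[OF Z] .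
  have fc: "\<And>a. a \<in> carrier H \<Longrightarrow> f a \<in> carrier Z"
    and f1: "f (one H) = one Z" and f0: "f (zero H) = zero Z"
    and fi: "\<And>a b. a \<in> carrier H \<Longrightarrow> b \<in> carrier H \<Longrightarrow> f (imp H a b) = imp Z (f a) (f b)"
    using f by (auto simp: PHil0_hom_def)
  note FQ = Z.irr_filterD(1)[OF Q] and FP = H.irr_filterD(1)[OF P]
  have Pc: "\<And>p. p \<in> P \<Longrightarrow> p \<in> carrier H" using H.irr_filterD(2)[OF P] by blast
  have Qc: "\<And>x. x \<in> Q \<Longrightarrow> x \<in> carrier Z" using Z.irr_filterD(2)[OF Q] by blast
  have totQ: "total_filter Z Q" using Z.irreducible_iff_total[OF PHil0D(2)[OF Z]] Q by blast
  define R where "R = {x \<in> carrier Z. \<exists>p \<in> P. imp Z (f p) x \<in> Q}"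
  have pre: "filter_preimage H f R = P"
  proof
    show "filter_preimage H f R \<subseteq> P"
    proof
      fix a assume "a \<in> filter_preimage H f R"
      then obtain p where p: "a \<in> carrier H" "p \<in> P" "f (imp H p a) \<in> Q"
        using fi Pc by (auto simp: filter_preimage_def R_def)
      then have "imp H p a \<in> P" using sub Pc H.imp_closed by (auto simp: filter_preimage_def)
      then show "a \<in> P" using H.filter_mp[OF FP p(2) _ p(1)] by blast
    qed
    show "P \<subseteq> filter_preimage H f R"
      using Pc fc Z.irr_filterD(4)[OF Q] by (force simp: filter_preimage_def R_def Z.imp_refl)
  qed
  have QR: "Q \<subseteq> R"
  proof
    fix x assume "x \<in> Q"
    then have "imp Z (f (one H)) x \<in> Q" using f1 Qc by (simp add: Z.one_imp)
    then show "x \<in> R" using \<open>x \<in> Q\<close> Qc H.irr_filterD(4)[OF P] by (auto simp: R_def)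
  qed
  have "implicative_filter Z R"
    unfolding implicative_filter_def
  proof (intro conjI ballI impI)
    show "R \<subseteq> carrier Z" by (auto simp: R_def)
    show "one Z \<in> R" using QR Z.irr_filterD(4)[OF Q] by blast
    fix x y assume c: "x \<in> carrier Z" "y \<in> carrier Z" and "x \<in> R \<and> imp Z x y \<in> R"
    then obtain p q where p: "p \<in> P" "imp Z (f p) x \<in> Q" and q: "q \<in> P" "imp Z (f q) (imp Z x y) \<in> Q"
      by (auto simp: R_def)
    note pq = fc[OF Pc[OF p(1)]] fc[OF Pc[OF q(1)]]
    have "\<exists>r \<in> P. imp Z (f r) x \<in> Q \<and> imp Z (f r) (imp Z x y) \<in> Q"
      using totQ[unfolded total_filter_def] pq p q c Z.filter_trans[OF FQ pq(1,2)] Z.filter_trans[OF FQ pq(2,1)]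
      by (metis Z.imp_closed)
    then obtain r where r: "r \<in> P" "imp Z (f r) x \<in> Q" "imp Z (f r) (imp Z x y) \<in> Q" by blast
    then have "imp Z (f r) y \<in> Q" using Z.filter_distrib[OF FQ fc[OF Pc] c] by blast
    then show "y \<in> R" using r c by (auto simp: R_def)
  qed
  then have "total_filter Z R" using totQ QR unfolding total_filter_def by blast
  moreover have "zero H \<notin> filter_preimage H f R" using zero_notin_irr_filter[OF H P] pre by simp
  then have "R \<noteq> carrier Z"
    using f0 PHil0_closed(2)[OF H] PHil0_closed(2)[OF Z] by (auto simp: filter_preimage_def)
  ultimately have "R \<in> irr_filters Z" using Z.irreducible_iff_total[OF PHil0D(2)[OF Z]] by blast
  then show thesis using that QR pre by blast
qed

text \<open>
  The extension takes an upset to its inverse image under \<open>Q \<mapsto> f\<^sup>-\<^sup>1(Q)\<close>. Only its compatibility with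
  the implication needs more than monotonicity: it is the lifting of inclusions.
\<close>

lemma star_extension:
  assumes H: "PHil0 H" and Z: "PHil0 Z" and f: "f \<in> PHil0_hom H Z"
  obtains F where "F \<in> PHey_hom (star H) (star Z)" "\<And>a. a \<in> carrier H \<Longrightarrow> F (phi H a) = phi Z (f a)"
proof -
  let ?p = "filter_preimage H f"
  define F where "F U = {Q \<in> irr_filters Z. ?p Q \<in> U}" for U
  note pi = filter_preimage_irreducible[OF H Z f]
  have phi: "F (phi H a) = phi Z (f a)" if "a \<in> carrier H" for a
    using that pi by (auto simp: F_def phi_def filter_preimage_def)
  have F_one: "F (irr_filters H) = irr_filters Z" using pi by (auto simp: F_def)
  have F_imp: "F (imp (upset_algebra (irr_filters H)) U V) = imp (upset_algebra (irr_filters Z)) (F U) (F V)"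
    for U V
  proof (rule Set.set_eqI)
    fix Q
    have "(\<forall>P \<in> irr_filters H. ?p Q \<subseteq> P \<and> P \<in> U \<longrightarrow> P \<in> V) \<longleftrightarrow>
        (\<forall>R \<in> irr_filters Z. Q \<subseteq> R \<and> ?p R \<in> U \<longrightarrow> ?p R \<in> V)" if Q: "Q \<in> irr_filters Z"
    proof (intro iffI ballI impI)
      fix R assume *: "\<forall>P \<in> irr_filters H. ?p Q \<subseteq> P \<and> P \<in> U \<longrightarrow> P \<in> V"
        and R: "R \<in> irr_filters Z" "Q \<subseteq> R \<and> ?p R \<in> U"
      then have "?p Q \<subseteq> ?p R" by (auto simp: filter_preimage_def)
      then show "?p R \<in> V" using * R pi by blast
    next
      fix P assume *: "\<forall>R \<in> irr_filters Z. Q \<subseteq> R \<and> ?p R \<in> U \<longrightarrow> ?p R \<in> V"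
        and P: "P \<in> irr_filters H" "?p Q \<subseteq> P \<and> P \<in> U"
      obtain R where "R \<in> irr_filters Z" "Q \<subseteq> R" "?p R = P"
        using filter_lifting[OF H Z f Q P(1)] P(2) by blast
      then show "P \<in> V" using * P by blast
    qed
    then show "Q \<in> F (imp (upset_algebra (irr_filters H)) U V) \<longleftrightarrow>
        Q \<in> imp (upset_algebra (irr_filters Z)) (F U) (F V)"
      using pi unfolding mem_upset_imp F_def by auto
  qed
  have closed: "F U \<in> carrier (star Z)" if "U \<in> carrier (star H)" for U
    using that unfolding star_simps
  proof induction
    case (base U)
    then obtain a where "a \<in> carrier H" "U = phi H a" by blast
    then show ?case using phi f by (auto simp: PHil0_hom_def intro!: heyting_span.base)
  next
    case one
    show ?case using heyting_span.one[of "upset_algebra (irr_filters Z)" "phi Z ` carrier Z"] F_one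
      by (simp add: upset_algebra_simps)
  next
    case zero
    show ?case using heyting_span.zero[of "upset_algebra (irr_filters Z)" "phi Z ` carrier Z"]
      by (simp add: upset_algebra_simps F_def)
  next
    case (imp U V)
    then show ?case by (simp add: F_imp heyting_span.imp)
  next
    case (meet U V)
    then show ?case using heyting_span.meet[OF meet.IH]
      by (simp add: upset_algebra_simps F_def Collect_conj_eq Int_ac)
  next
    case (join U V)
    moreover have "F (U \<union> V) = F U \<union> F V" by (auto simp: F_def)
    ultimately show ?case using heyting_span.join[OF join.IH] by (simp add: upset_algebra_simps)
  qed
  have "F \<in> PHey_hom (star H) (star Z)"
    using closed F_one F_imp by (auto simp: PHey_hom_def star_simps F_def)
  then show thesis using phi that by blast
qed

section \<open>Coproducts\<close>

lemma PHil0_coproduct_of_star_coproduct: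
  fixes H :: "'a hilbert0" and G :: "'b hilbert0" and C :: "'c heyting"
    and iH :: "'a set set \<Rightarrow> 'c" and iG :: "'b set set \<Rightarrow> 'c"
  assumes H: "PHil0 H" and G: "PHil0 G"
    and co: "PHey_coproduct TYPE(('a set set + 'b set set + 'c) heyting_term) (star H) (star G) C iH iG"
    and \<eta>: "\<eta> = iH ` (phi H ` carrier H) \<union> iG ` (phi G ` carrier G)"
  shows "PHil0_coproduct TYPE('z) H G (hilbert_generated C \<eta>) (iH \<circ> phi H) (iG \<circ> phi G)"
proof -
  let ?K = "hilbert_generated C \<eta>"
  have C: "PHey C" and iH: "iH \<in> PHey_hom (star H) C" and iG: "iG \<in> PHey_hom (star G) C"
    using co by (auto simp: PHey_coproduct_def)
  have jH: "iH \<circ> phi H \<in> PHil0_hom H C" and jG: "iG \<circ> phi G \<in> PHil0_hom G C"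
    using PHil0_hom_comp[OF phi_hom PHey_hom_imp_PHil0_hom] H G iH iG by blast+
  have \<eta>C: "\<eta> \<subseteq> carrier C"
    using jH jG by (auto simp: \<eta> PHil0_hom_def)
  have "zero C = (iH \<circ> phi H) (zero H)" using jH by (auto simp: PHil0_hom_def)
  then have zero: "zero C \<in> hilbert_span C \<eta>"
    using PHil0_closed(2)[OF H] by (auto simp: \<eta> intro!: hilbert_span.base)
  have K: "PHil0 ?K" by (rule PHil0_hilbert_generated[OF PHey_imp_PHil0[OF C] \<eta>C zero])
  have jHK: "iH \<circ> phi H \<in> PHil0_hom H ?K" and jGK: "iG \<circ> phi G \<in> PHil0_hom G ?K"
    using jH jG by (auto simp: PHil0_hom_def hilbert_generated_def \<eta> intro: hilbert_span.base)
  have spanC: "hilbert_span C \<eta> \<subseteq> carrier C" by (rule hilbert_span_sub[OF PHey_imp_PHil0[OF C] \<eta>C])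
  have "\<exists>h \<in> PHil0_hom ?K Z.
        (\<forall>x \<in> carrier H. h ((iH \<circ> phi H) x) = f x) \<and> (\<forall>y \<in> carrier G. h ((iG \<circ> phi G) y) = g y) \<and>
        (\<forall>h' \<in> PHil0_hom ?K Z.
          (\<forall>x \<in> carrier H. h' ((iH \<circ> phi H) x) = f x) \<and> (\<forall>y \<in> carrier G. h' ((iG \<circ> phi G) y) = g y) \<longrightarrow>
          (\<forall>z \<in> carrier ?K. h' z = h z))"
    if Z: "PHil0 Z" and f: "f \<in> PHil0_hom H Z" and g: "g \<in> PHil0_hom G Z"
    for Z :: "'z hilbert0" and f g
  proof -
    interpret Z: hilbert_algebra Z using PHil0D(1)[OF Z] .
    obtain F where F: "F \<in> PHey_hom (star H) (star Z)" "\<And>a. a \<in> carrier H \<Longrightarrow> F (phi H a) = phi Z (f a)"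
      using star_extension[OF H Z f] by blast
    obtain F' where F': "F' \<in> PHey_hom (star G) (star Z)" "\<And>a. a \<in> carrier G \<Longrightarrow> F' (phi G a) = phi Z (g a)"
      using star_extension[OF G Z g] by blast
    have "PHey_coproduct TYPE('z set set) (star H) (star G) C iH iG"
      by (rule PHey_coproduct_any_type[OF PHey_star[OF H] PHey_star[OF G] co])
    note this[unfolded PHey_coproduct_def, THEN conjunct2, THEN conjunct2, THEN conjunct2,
      THEN spec, THEN spec, THEN spec, THEN mp, OF conjI[OF PHey_star[OF Z] conjI[OF F(1) F'(1)]]]
    then obtain h where h: "h \<in> PHey_hom C (star Z)"
      "\<forall>U \<in> carrier (star H). h (iH U) = F U" "\<forall>U \<in> carrier (star G). h (iG U) = F' U"
      by (elim bexE conjE) (rule that)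
    have phic: "\<And>a. a \<in> carrier H \<Longrightarrow> phi H a \<in> carrier (star H)"
      "\<And>a. a \<in> carrier G \<Longrightarrow> phi G a \<in> carrier (star G)"
      using phi_hom[OF H] phi_hom[OF G] by (auto simp: PHil0_hom_def)
    have hgen: "\<And>a. a \<in> carrier H \<Longrightarrow> h (iH (phi H a)) = phi Z (f a)"
      "\<And>a. a \<in> carrier G \<Longrightarrow> h (iG (phi G a)) = phi Z (g a)"
      using h F F' phic by simp_all
    have fc: "\<And>a. a \<in> carrier H \<Longrightarrow> f a \<in> carrier Z" "\<And>a. a \<in> carrier G \<Longrightarrow> g a \<in> carrier Z"
      using f g by (auto simp: PHil0_hom_def)
    \<comment> \<open>\<open>\<phi>(Z)\<close> is closed under implication, so that \<open>h\<close> cannot leave it on the span of \<open>\<eta>\<close>\<close>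
    have range: "h x \<in> phi Z ` carrier Z" if "x \<in> hilbert_span C \<eta>" for x
      using that
    proof induction
      case (base x)
      then show ?case using hgen fc by (auto simp: \<eta>)
    next
      case one
      have "h (one C) = phi Z (one Z)"
        using h(1) phi_hom[OF Z] by (simp add: PHey_hom_def PHil0_hom_def)
      then show ?case using Z.one_closed by blast
    next
      case (imp x y)
      then obtain a b where ab: "a \<in> carrier Z" "b \<in> carrier Z" "h x = phi Z a" "h y = phi Z b" by blast
      have "h (imp C x y) = imp (star Z) (h x) (h y)"
        using subsetD[OF spanC imp.hyps(1)] subsetD[OF spanC imp.hyps(2)] h(1)
        by (simp add: PHey_hom_def)
      also have "\<dots> = phi Z (imp Z a b)" using ab phi_hom[OF Z] by (simp add: PHil0_hom_def)
      finally show ?case using ab Z.imp_closed by blast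
    qed
    have "h \<in> PHil0_hom ?K (star Z)"
      using PHey_hom_imp_PHil0_hom[OF h(1)] subsetD[OF spanC]
      by (simp add: PHil0_hom_def hilbert_generated_def image_subset_iff)
    then obtain k where k: "k \<in> PHil0_hom ?K Z" "\<And>x. x \<in> carrier ?K \<Longrightarrow> phi Z (k x) = h x"
      using PHil0_hom_factor[OF K Z phi_hom[OF Z] Z.phi_inj, of h] range
      by (auto simp: hilbert_generated_def)
    have kc: "\<And>x. x \<in> carrier ?K \<Longrightarrow> k x \<in> carrier Z" using k(1) by (auto simp: PHil0_hom_def)
    have jc: "\<And>a. a \<in> carrier H \<Longrightarrow> iH (phi H a) \<in> carrier ?K" "\<And>a. a \<in> carrier G \<Longrightarrow> iG (phi G a) \<in> carrier ?K"
      using jHK jGK by (auto simp: PHil0_hom_def)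
    have kH: "\<forall>x \<in> carrier H. k ((iH \<circ> phi H) x) = f x"
      using k(2) jc hgen kc fc by (auto intro!: inj_onD[OF Z.phi_inj])
    have kG: "\<forall>x \<in> carrier G. k ((iG \<circ> phi G) x) = g x"
      using k(2) jc hgen kc fc by (auto intro!: inj_onD[OF Z.phi_inj])
    have "\<forall>z \<in> carrier ?K. h' z = k z"
      if "h' \<in> PHil0_hom ?K Z" "\<forall>x \<in> carrier H. h' ((iH \<circ> phi H) x) = f x"
        "\<forall>y \<in> carrier G. h' ((iG \<circ> phi G) y) = g y" for h'
    proof
      fix z assume "z \<in> carrier ?K"
      then have z: "z \<in> hilbert_span ?K \<eta>" by (simp add: hilbert_span_generated) (simp add: hilbert_generated_def)
      have "\<eta> \<subseteq> carrier ?K" by (auto simp: hilbert_generated_def intro: hilbert_span.base)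
      then show "h' z = k z"
        by (rule PHil0_hom_eq_on_span[OF K _ k(1) that(1) _ z]) (use that(2,3) kH kG in \<open>auto simp: \<eta>\<close>)
    qed
    then show ?thesis using k(1) kH kG by blast
  qed
  then show ?thesis unfolding PHil0_coproduct_def using K jHK jGK by blast
qed

lemma PHil0_coproduct_unique:
  fixes K :: "'k hilbert0" and L :: "'l hilbert0"
  assumes KK: "PHil0_coproduct TYPE('k) H G K i j" and KL: "PHil0_coproduct TYPE('l) H G K i j"
    and LK: "PHil0_coproduct TYPE('k) H G L i' j'" and LL: "PHil0_coproduct TYPE('l) H G L i' j'"
  shows "PHil0_isomorphic K L"
proof -
  note K = KK[unfolded PHil0_coproduct_def] and L = LL[unfolded PHil0_coproduct_def]
  obtain h where h: "h \<in> PHil0_hom K L" "\<forall>x \<in> carrier H. h (i x) = i' x" "\<forall>y \<in> carrier G. h (j y) = j' y"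
    using KL[unfolded PHil0_coproduct_def] L by blast
  obtain k where k: "k \<in> PHil0_hom L K" "\<forall>x \<in> carrier H. k (i' x) = i x" "\<forall>y \<in> carrier G. k (j' y) = j y"
    using LK[unfolded PHil0_coproduct_def] K by blast
  have endo: "m z = z"
    if M: "PHil0_coproduct TYPE('m) H G M u v" and m: "m \<in> PHil0_hom M M"
      "\<forall>x \<in> carrier H. m (u x) = u x" "\<forall>y \<in> carrier G. m (v y) = v y" and z: "z \<in> carrier M"
    for M :: "'m hilbert0" and u v m z
  proof -
    obtain e where e: "\<forall>m' \<in> PHil0_hom M M.
        (\<forall>x \<in> carrier H. m' (u x) = u x) \<and> (\<forall>y \<in> carrier G. m' (v y) = v y) \<longrightarrow>
        (\<forall>z \<in> carrier M. m' z = e z)"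
      using M unfolding PHil0_coproduct_def by metis
    have "m z = e z" using e m z by blast
    moreover have "id z = e z" using e z PHil0_hom_id[of M] by (metis id_apply)
    ultimately show ?thesis by simp
  qed
  have "k (h z) = z" if "z \<in> carrier K" for z
    using endo[OF KK PHil0_hom_comp[OF h(1) k(1)] _ _ that] h k by simp
  moreover have "h (k z) = z" if "z \<in> carrier L" for z
    using endo[OF LL PHil0_hom_comp[OF k(1) h(1)] _ _ that] h k by simp
  ultimately have "bij_betw h (carrier K) (carrier L)"
    using h(1) k(1) by (intro bij_betw_byWitness[of _ k]) (auto simp: PHil0_hom_def)
  then show ?thesis using h(1) by (auto simp: PHil0_isomorphic_def)
qed

theorem proposition20:
  fixes H :: "'a hilbert0" and G :: "'b hilbert0" and C :: "'c heyting"
    and iH :: "'a set set \<Rightarrow> 'c" and iG :: "'b set set \<Rightarrow> 'c"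
  assumes "PHil0 H" and "PHil0 G"
    and "PHey_coproduct TYPE(('a set set + 'b set set + 'c) heyting_term) (star H) (star G) C iH iG"
    and "\<eta> = iH ` (phi H ` carrier H) \<union> iG ` (phi G ` carrier G)"
  shows "PHil0_coproduct TYPE('z) H G (hilbert_generated C \<eta>) (iH \<circ> phi H) (iG \<circ> phi G) \<and>
    (\<forall>(K :: 'k hilbert0) jH jG.
      PHil0_coproduct TYPE(('a + 'b + 'k) hilbert_term) H G K jH jG \<longrightarrow>
      PHil0_isomorphic K (hilbert_generated C \<eta>))"
proof (intro conjI allI impI)
  show "PHil0_coproduct TYPE('z) H G (hilbert_generated C \<eta>) (iH \<circ> phi H) (iG \<circ> phi G)"
    by (rule PHil0_coproduct_of_star_coproduct) fact+
  fix K :: "'k hilbert0" and jH jG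
  assume "PHil0_coproduct TYPE(('a + 'b + 'k) hilbert_term) H G K jH jG"
  note K = PHil0_coproduct_any_type[OF assms(1,2) this]
  note gen = PHil0_coproduct_of_star_coproduct[OF assms]
  show "PHil0_isomorphic K (hilbert_generated C \<eta>)"
    by (rule PHil0_coproduct_unique[OF K K gen gen])
qed

end
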